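(* Consider, for each $n\in\mathbb{N}$, independent observations $Y_{ni}=\mu_n(x_{ni})+\varepsilon_{ni}$, $1\le i\le n$, with fixed design points $x_{ni}\in\mathcal{X}_n:=\mathbb{R}^{q(n)}$, regression function $\mu_n\in\mathcal{M}_n$, and independent random errors $\varepsilon_{n1},\ldots,\varepsilon_{nn}$ with mean zero and common distribution $Q_n\in\mathcal{Q}_o(1)\cap\mathcal{Q}^1(1)$, where $\mathcal{M}_n$ is the family of all affine functions on $\mathbb{R}^{q(n)}$. Suppose that $D_1(Q_n,Q)\to0$ for some distribution $Q\in\mathcal{Q}_o(1)\cap\mathcal{Q}^1(1)$. If $$\lim_{n\to\infty}q(n)/n=0,$$ then for arbitrary fixed $c>0$, $$\sup_{m\in\mathcal{M}_n:\,\|(m-\mu_n)(\boldsymbol{x}_n)\|_n\le c}D_{\mathrm{BL}}(\hat Q_{n,m},Q_{n,m})\to_p0\qquad(n\to\infty).$$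
   Context: Notation: $\boldsymbol{x}_n=(x_{ni})_{i=1}^n$, $m(\boldsymbol{x}_n)=(m(x_{ni}))_{i=1}^n$, and $\|\boldsymbol{v}\|_n:=\frac1n\sum_{i=1}^n|v_i|$ for $\boldsymbol{v}\in\mathbb{R}^n$. $\to_p$ denotes convergence in probability. $\mathcal{Q}^1(1)$: probability distributions on $\mathbb{R}$ with finite first moment. $\mathcal{Q}_o(1)$: probability distributions on $\mathbb{R}$ whose convex support (the intersection of all closed convex sets of probability one) has nonempty interior, i.e. which are not Dirac measures. $D_1(Q,Q'):=\inf\mathbb{E}|X-X'|$ over all couplings $X\sim Q$, $X'\sim Q'$ (Mallows/Wasserstein-1 distance). $D_{\mathrm{BL}}(Q,Q'):=\sup_{h\in\mathcal{H}_{\mathrm{BL}}}\left|\int h\,d(Q-Q')\right|$, where $\mathcal{H}_{\mathrm{BL}}$ is the family of all $h:\mathbb{R}\to[-1,1]$ with $|h(x)-h(y)|\le|x-y|$ for all $x,y\in\mathbb{R}$. $\hat Q_{n,m}:=\frac1n\sum_{i=1}^n\delta_{Y_{ni}-m(x_{ni})}$ is the empirical distribution of the residuals, and $Q_{n,m}:=\mathbb{E}\hat Q_{n,m}=Q_n\star\bigl(\frac1n\sum_{i=1}^n\delta_{\mu_n(x_{ni})-m(x_{ni})}\bigr)$ is its expectation measure ($\star$ = convolution). *)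

theory Defs
  imports "HOL-Probability.Probability"
begin

section \<open>Distributions on the real line and distances between them\<close>

text \<open>The intersection of all closed convex sets of probability one.\<close>

definition convex_support :: "real measure \<Rightarrow> real set" where
  "convex_support Q = \<Inter>{C. closed C \<and> convex C \<and> emeasure Q C = 1}"

definition nondegenerate_distributions :: "real measure set" where
  "nondegenerate_distributions =
     {Q. real_distribution Q \<and> interior (convex_support Q) \<noteq> {}}"

definition integrable_distributions :: "real measure set" where
  "integrable_distributions = {Q. real_distribution Q \<and> integrable Q (\<lambda>x. \<bar>x\<bar>)}"

text \<open>Couplings are given by their joint laws on the plane.\<close>

definition couplings :: "real measure \<Rightarrow> real measure \<Rightarrow> (real \<times> real) measure set" where
  "couplings Q Q' =
     {P. prob_space P \<and> sets P = sets borel \<and> distr P borel fst = Q \<and> distr P borel snd = Q'}"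

definition mallows_dist :: "real measure \<Rightarrow> real measure \<Rightarrow> ennreal" where
  "mallows_dist Q Q' = (INF P\<in>couplings Q Q'. \<integral>\<^sup>+ (x, x'). ennreal \<bar>x - x'\<bar> \<partial>P)"

definition BL_functions :: "(real \<Rightarrow> real) set" where
  "BL_functions = {h. (\<forall>x. h x \<in> {-1..1}) \<and> (\<forall>x y. \<bar>h x - h y\<bar> \<le> \<bar>x - y\<bar>)}"

text \<open>For probability measures on the Borel sets all integrals below exist, and the
  supremum is over a nonempty set of reals that is bounded by 2.\<close>

definition BL_dist :: "real measure \<Rightarrow> real measure \<Rightarrow> real" where
  "BL_dist Q Q' = (SUP h\<in>BL_functions. \<bar>(\<integral>x. h x \<partial>Q) - (\<integral>x. h x \<partial>Q')\<bar>)"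


section \<open>Linear regression\<close>

text \<open>\<open>\<real>\<^sup>q\<close> is the carrier of \<^const>\<open>Euclidean_space\<close>: the sequences vanishing from index
  \<open>q\<close> on. Regression functions are total functions on sequences, of which only the values on
  this carrier matter.\<close>

definition affine_functions :: "nat \<Rightarrow> ((nat \<Rightarrow> real) \<Rightarrow> real) set" where
  "affine_functions q =
     {m. \<exists>a b. \<forall>x\<in>topspace (Euclidean_space q). m x = a + (\<Sum>j<q. b j * x j)}"

definition avg_norm :: "nat \<Rightarrow> (nat \<Rightarrow> real) \<Rightarrow> real" where
  "avg_norm n v = (\<Sum>i=1..n. \<bar>v i\<bar>) / real n"

text \<open>The mean of the Dirac measures at \<open>v 1, \<dots>, v n\<close>, counted with multiplicity.\<close>

definition empirical_measure :: "nat \<Rightarrow> (nat \<Rightarrow> real) \<Rightarrow> real measure" where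
  "empirical_measure n v = distr (uniform_count_measure {1..n}) borel v"

lemma emeasure_empirical_measure:
  assumes "0 < n" "A \<in> sets borel"
  shows "emeasure (empirical_measure n v) A =
    (\<Sum>i=1..n. emeasure (return borel (v i)) A) / of_nat n"
proof -
  have "emeasure (empirical_measure n v) A =
      emeasure (uniform_count_measure {1..n}) (v -` A \<inter> {1..n})"
    using assms unfolding empirical_measure_def
    by (subst emeasure_distr) (auto simp: space_uniform_count_measure)
  also have "\<dots> = of_nat (card (v -` A \<inter> {1..n})) / of_nat n"
    using assms by (subst emeasure_uniform_count_measure)
      (auto simp: divide_ennreal ennreal_of_nat_eq_real_of_nat)
  also have "of_nat (card (v -` A \<inter> {1..n})) = (\<Sum>i=1..n. indicator A (v i) :: ennreal)"
    by (simp add: indicator_def sum.If_cases Int_def vimage_def conj_commute)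
  also have "\<dots> = (\<Sum>i=1..n. emeasure (return borel (v i)) A)"
    using assms by (intro sum.cong) auto
  finally show ?thesis .
qed

lemma sets_empirical_measure [simp, measurable_cong]:
  "sets (empirical_measure n v) = sets borel"
  by (simp add: empirical_measure_def)

lemma prob_space_empirical_measure:
  assumes "0 < n"
  shows "prob_space (empirical_measure n v)"
  unfolding empirical_measure_def using assms
  by (intro prob_space.prob_space_distr prob_space_uniform_count_measure)
     (auto simp: measurable_def sets_uniform_count_measure space_uniform_count_measure)

definition residual_distribution ::
    "nat \<Rightarrow> (nat \<Rightarrow> nat \<Rightarrow> real) \<Rightarrow> (nat \<Rightarrow> 'a \<Rightarrow> real) \<Rightarrow> ((nat \<Rightarrow> real) \<Rightarrow> real) \<Rightarrow> 'a \<Rightarrow> real measure"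
  where "residual_distribution n x Y m \<omega> = empirical_measure n (\<lambda>i. Y i \<omega> - m (x i))"

text \<open>The expectation measure of the random measure above, that is, the measure assigning to a
  Borel set the expectation of its random mass (monadic bind of the Giry monad).\<close>

definition expected_residual_distribution ::
    "'a measure \<Rightarrow> nat \<Rightarrow> (nat \<Rightarrow> nat \<Rightarrow> real) \<Rightarrow> (nat \<Rightarrow> 'a \<Rightarrow> real) \<Rightarrow> ((nat \<Rightarrow> real) \<Rightarrow> real) \<Rightarrow> real measure"
  where "expected_residual_distribution M n x Y m = M \<bind> residual_distribution n x Y m"

lemma measurable_residual_distribution:
  assumes "0 < n" and Y: "\<And>i. i \<in> {1..n} \<Longrightarrow> Y i \<in> borel_measurable M"
  shows "residual_distribution n x Y m \<in> measurable M (subprob_algebra borel)"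
proof (rule measurable_subprob_algebra)
  fix \<omega> assume "\<omega> \<in> space M"
  show "subprob_space (residual_distribution n x Y m \<omega>)"
    unfolding residual_distribution_def
    using assms by (intro prob_space_imp_subprob_space prob_space_empirical_measure)
  show "sets (residual_distribution n x Y m \<omega>) = sets borel"
    by (simp add: residual_distribution_def)
next
  fix A :: "real set" assume A [measurable]: "A \<in> sets borel"
  have "(\<lambda>\<omega>. (\<Sum>i=1..n. indicator A (Y i \<omega> - m (x i)) :: ennreal) / of_nat n)
      \<in> borel_measurable M"
    using Y by (auto intro!: borel_measurable_divide_ennreal borel_measurable_sum)
  then show "(\<lambda>\<omega>. emeasure (residual_distribution n x Y m \<omega>) A) \<in> borel_measurable M"
    using assms(1) by (simp add: residual_distribution_def emeasure_empirical_measure)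
qed

lemma expected_residual_distribution_eq_convolution:
  assumes M: "prob_space M" and n: "0 < n"
    and eps: "\<And>i. i \<in> {1..n} \<Longrightarrow> eps i \<in> borel_measurable M"
    and Q: "\<And>i. i \<in> {1..n} \<Longrightarrow> distr M borel (eps i) = Q"
    and Y: "\<And>i \<omega>. i \<in> {1..n} \<Longrightarrow> \<omega> \<in> space M \<Longrightarrow> Y i \<omega> = \<mu> (x i) + eps i \<omega>"
  shows "expected_residual_distribution M n x Y m =
    convolution Q (empirical_measure n (\<lambda>i. \<mu> (x i) - m (x i)))"
proof (rule measure_eqI)
  interpret prob_space M by (rule M)
  have Ym: "Y i \<in> borel_measurable M" if "i \<in> {1..n}" for i
  proof -
    have "Y i \<in> borel_measurable M \<longleftrightarrow> (\<lambda>\<omega>. \<mu> (x i) + eps i \<omega>) \<in> borel_measurable M"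
      using Y that by (intro measurable_cong) auto
    with eps[OF that] show ?thesis by simp
  qed
  note K = measurable_residual_distribution[where x=x and m=m, OF n Ym]
  show "sets (expected_residual_distribution M n x Y m) =
      sets (convolution Q (empirical_measure n (\<lambda>i. \<mu> (x i) - m (x i))))"
    unfolding expected_residual_distribution_def
    using sets_bind[OF sets_kernel[OF K] not_empty] by simp
  fix A assume "A \<in> sets (expected_residual_distribution M n x Y m)"
  then have A [measurable]: "A \<in> sets borel"
    unfolding expected_residual_distribution_def
    using sets_bind[OF sets_kernel[OF K] not_empty] by simp
  let ?E = "empirical_measure n (\<lambda>i. \<mu> (x i) - m (x i))"
  have 1: "1 \<in> {1..n}" using n by auto
  have Qp: "prob_space Q"
    using prob_space_distr[OF eps[OF 1]] Q[OF 1] by simp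
  have Qs [measurable_cong]: "sets Q = sets borel" using Q[OF 1] by auto
  interpret Q: prob_space Q by (rule Qp)
  interpret E: prob_space ?E by (rule prob_space_empirical_measure[OF n])
  interpret QE: pair_sigma_finite Q ?E ..
  have meas: "(\<lambda>\<omega>. indicator A (eps i \<omega> + (\<mu> (x i) - m (x i))) :: ennreal) \<in> borel_measurable M"
    if "i \<in> {1..n}" for i
  proof -
    note [measurable] = eps[OF that]
    show ?thesis by measurable
  qed
  have "emeasure (expected_residual_distribution M n x Y m) A =
      (\<integral>\<^sup>+\<omega>. emeasure (residual_distribution n x Y m \<omega>) A \<partial>M)"
    unfolding expected_residual_distribution_def
    by (rule emeasure_bind[OF not_empty K A])
  also have "\<dots> = (\<integral>\<^sup>+\<omega>. (\<Sum>i=1..n. indicator A (eps i \<omega> + (\<mu> (x i) - m (x i)))) / of_nat n \<partial>M)"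
    using n by (intro nn_integral_cong)
      (simp add: residual_distribution_def emeasure_empirical_measure Y algebra_simps)
  also have "\<dots> = (\<Sum>i=1..n. \<integral>\<^sup>+\<omega>. indicator A (eps i \<omega> + (\<mu> (x i) - m (x i))) \<partial>M) / of_nat n"
    by (simp only: nn_integral_divide[OF borel_measurable_sum[OF meas]] nn_integral_sum[OF meas])
  also have "(\<Sum>i=1..n. \<integral>\<^sup>+\<omega>. indicator A (eps i \<omega> + (\<mu> (x i) - m (x i))) \<partial>M) =
      (\<Sum>i=1..n. \<integral>\<^sup>+y. indicator A (y + (\<mu> (x i) - m (x i))) \<partial>Q)"
    using eps by (intro sum.cong refl) (simp add: Q[symmetric] nn_integral_distr)
  also have "\<dots> / of_nat n =
      (\<integral>\<^sup>+y. (\<Sum>i=1..n. indicator A (y + (\<mu> (x i) - m (x i)))) / of_nat n \<partial>Q)"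
    by (subst nn_integral_divide) (auto simp: nn_integral_sum)
  also have "\<dots> = (\<integral>\<^sup>+y. (\<integral>\<^sup>+z. indicator A (y + z) \<partial>?E) \<partial>Q)"
  proof (intro nn_integral_cong)
    fix y :: real
    have B: "(+) y -` A \<in> sets borel"
      using measurable_sets[of "(+) y" borel borel A] by simp
    have "(\<integral>\<^sup>+z. indicator A (y + z) \<partial>?E) = (\<integral>\<^sup>+z. indicator ((+) y -` A) z \<partial>?E)"
      by (intro nn_integral_cong) (auto simp: indicator_def)
    also have "\<dots> = emeasure ?E ((+) y -` A)"
      using B by (intro nn_integral_indicator) simp
    also have "\<dots> = (\<Sum>i=1..n. indicator A (y + (\<mu> (x i) - m (x i)))) / of_nat n"
      using B by (simp add: emeasure_empirical_measure[OF n] indicator_def)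
    finally show "(\<Sum>i=1..n. indicator A (y + (\<mu> (x i) - m (x i)))) / of_nat n =
        (\<integral>\<^sup>+z. indicator A (y + z) \<partial>?E)" by simp
  qed
  also have "\<dots> = emeasure (convolution Q ?E) A"
    by (rule convolution_emeasure'[symmetric])
       (auto simp: Qs Q.finite_measure_axioms E.finite_measure_axioms)
  finally show "emeasure (expected_residual_distribution M n x Y m) A = emeasure (convolution Q ?E) A" .
qed


section \<open>Convergence in probability\<close>

text \<open>The underlying probability space may change with the index. Measurability is part of the
  definition because \<^const>\<open>measure\<close> is 0 on sets that are not measurable; it is required only
  eventually since finitely many indices are irrelevant.\<close>

definition tendsto_in_probability ::
    "(nat \<Rightarrow> 'a measure) \<Rightarrow> (nat \<Rightarrow> 'a \<Rightarrow> real) \<Rightarrow> real \<Rightarrow> bool" where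
  "tendsto_in_probability M X l \<longleftrightarrow>
     (\<forall>\<^sub>F n in sequentially. X n \<in> borel_measurable (M n)) \<and>
     (\<forall>\<delta>>0. (\<lambda>n. measure (M n) {\<omega> \<in> space (M n). \<bar>X n \<omega> - l\<bar> > \<delta>}) \<longlonglongrightarrow> 0)"

end

theory Submission
  imports Defs
begin

text \<open>
  Write \<open>v i = m (x i) - \<mu> (x i)\<close>, so that the residuals are \<open>\<epsilon> i - v i\<close> and the bounded Lipschitz
  distance in question is the supremum over test functions \<open>h\<close> of
  \<open>\<bar>\<Sum>i. h (\<epsilon> i - v i) - E (h (\<epsilon> i - v i))\<bar> / n\<close> (lemma \<open>BL_dist_eq_BL_deviation\<close>). For one \<open>v\<close> and
  one \<open>h\<close>, Hoeffding's inequality bounds the probability that this exceeds \<open>\<delta>\<close> by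
  \<open>2 * exp (- n * \<delta>\<^sup>2 / 2)\<close>. The theorem holds because only \<open>exp (o(n))\<close> pairs \<open>(v, h)\<close> have to be
  considered.

  The vectors \<open>v\<close> form a ball in the averaged \<open>L\<^sup>1\<close> norm of a space of dimension at most \<open>q + 1\<close>, and
  the deviation is Lipschitz in \<open>v\<close> with respect to that norm. Such a ball is covered by \<open>k ^ (q + 1)\<close>
  balls of radius \<open>\<delta>\<close>, where \<open>k\<close> depends only on the ratio of the radii (\<open>ball_covering\<close>), and this
  number is \<open>exp (o(n))\<close> since \<open>q / n\<close> tends to 0. The bound on the number of balls does
  not use volumes. A crude pigeonhole bound with the right exponent but an uncontrolled constant
  suffices, since it may be applied to the base-\<open>k\<close> expansions with digits in a given separated set:
  their number is a power of its cardinality, and the constant is lost in the limit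
  (\<open>packing_bound\<close>).

  The test functions have a finite net on every compact interval \<open>[-K, K]\<close>. Outside of it, the bound
  \<open>2 / K * \<bar>r\<bar>\<close> on the difference of two of them is integrable, and its average over the residuals is
  at most \<open>2 / K\<close> times the average of \<open>\<bar>\<epsilon> i\<bar>\<close> plus \<open>c\<close> (\<open>BL_functions_finite_net\<close>, \<open>deviation_net\<close>).
  By Markov's inequality this average is bounded in probability, because convergence in the Mallows
  distance keeps the first moments of the error distributions bounded.
\<close>


section \<open>Coverings of balls in spaces of small dimension\<close>

lemma avg_norm_nonneg: "0 \<le> avg_norm n v"
  by (simp add: avg_norm_def sum_nonneg)

lemma avg_norm_cong:
  assumes "\<And>i. i \<in> {1..n} \<Longrightarrow> \<bar>u i\<bar> = \<bar>v i\<bar>"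
  shows "avg_norm n u = avg_norm n v"
  using assms by (simp add: avg_norm_def)

lemma avg_norm_triangle:
  assumes "\<And>i. i \<in> {1..n} \<Longrightarrow> \<bar>w i\<bar> \<le> \<bar>u i\<bar> + \<bar>v i\<bar>"
  shows "avg_norm n w \<le> avg_norm n u + avg_norm n v"
proof -
  have "(\<Sum>i=1..n. \<bar>w i\<bar>) \<le> (\<Sum>i=1..n. \<bar>u i\<bar> + \<bar>v i\<bar>)"
    using assms by (intro sum_mono) auto
  then show ?thesis
    by (simp add: avg_norm_def sum.distrib flip: add_divide_distrib divide_right_mono)
      (simp add: divide_right_mono)
qed

lemma avg_norm_scale: "avg_norm n (\<lambda>i. r * v i) = \<bar>r\<bar> * avg_norm n v"
  by (simp add: avg_norm_def abs_mult sum_distrib_left)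

lemma abs_le_avg_norm:
  assumes "i \<in> {1..n}"
  shows "\<bar>v i\<bar> \<le> real n * avg_norm n v"
proof -
  have "\<bar>v i\<bar> \<le> (\<Sum>i=1..n. \<bar>v i\<bar>)"
    using assms by (intro member_le_sum) auto
  then show ?thesis using assms by (simp add: avg_norm_def)
qed

text \<open>Only the values on \<open>{1..n}\<close> are constrained, so that every function that agrees there with a
  linear combination of \<open>b 0, \<dots>, b (d - 1)\<close> belongs to the space.\<close>

definition combinations :: "nat \<Rightarrow> nat \<Rightarrow> (nat \<Rightarrow> nat \<Rightarrow> real) \<Rightarrow> (nat \<Rightarrow> real) set" where
  "combinations n d b = {v. \<exists>t. \<forall>i\<in>{1..n}. v i = (\<Sum>j<d. t j * b j i)}"

lemma combinations_zero: "(\<lambda>_. 0) \<in> combinations n d b"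
  unfolding combinations_def by (auto intro!: exI[of _ "\<lambda>_. 0"])

lemma combinations_add_scaled:
  assumes "u \<in> combinations n d b" "v \<in> combinations n d b"
  shows "(\<lambda>i. u i + r * v i) \<in> combinations n d b"
proof -
  obtain s t where "\<forall>i\<in>{1..n}. u i = (\<Sum>j<d. s j * b j i)" "\<forall>i\<in>{1..n}. v i = (\<Sum>j<d. t j * b j i)"
    using assms by (auto simp: combinations_def)
  then have "\<forall>i\<in>{1..n}. u i + r * v i = (\<Sum>j<d. (s j + r * t j) * b j i)"
    by (simp add: algebra_simps sum.distrib sum_distrib_left)
  then show ?thesis unfolding combinations_def by (intro CollectI exI[of _ "\<lambda>j. s j + r * t j"])
qed

text \<open>Gaussian elimination: if the residual of a new generator after interpolation at \<open>I\<close> does not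
  vanish, then any point where it is nonzero recovers the new coefficient.\<close>

lemma interpolation_points:
  "\<exists>I C. I \<subseteq> {1..n} \<and> card I \<le> d \<and>
     (\<forall>v\<in>combinations n d b. \<forall>i\<in>{1..n}. v i = (\<Sum>k\<in>I. C i k * v k))"
proof (induction d)
  case 0
  then show ?case by (intro exI[of _ "{}"]) (auto simp: combinations_def)
next
  case (Suc d)
  then obtain I C where I: "I \<subseteq> {1..n}" "card I \<le> d"
    and C: "\<And>v i. v \<in> combinations n d b \<Longrightarrow> i \<in> {1..n} \<Longrightarrow> v i = (\<Sum>k\<in>I. C i k * v k)"
    by metis
  have fin: "finite I" using I(1) finite_subset by blast
  define r where "r i = b d i - (\<Sum>k\<in>I. C i k * b d k)" for i
  have split: "\<exists>t. \<forall>i\<in>{1..n}. v i - (\<Sum>k\<in>I. C i k * v k) = t * r i"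
    if v: "v \<in> combinations n (Suc d) b" for v
  proof -
    obtain t where t: "\<forall>i\<in>{1..n}. v i = (\<Sum>j<Suc d. t j * b j i)"
      using v by (auto simp: combinations_def)
    define u where "u i = (\<Sum>j<d. t j * b j i)" for i
    have u: "u \<in> combinations n d b" by (auto simp: combinations_def u_def)
    have vu: "v i = u i + t d * b d i" if "i \<in> {1..n}" for i
      using t that by (simp add: u_def)
    have "v i - (\<Sum>k\<in>I. C i k * v k) = t d * r i" if i: "i \<in> {1..n}" for i
    proof -
      have "(\<Sum>k\<in>I. C i k * v k) = (\<Sum>k\<in>I. C i k * u k + t d * (C i k * b d k))"
        using I(1) by (intro sum.cong refl) (auto simp: vu subset_iff algebra_simps)
      also have "\<dots> = u i + t d * (\<Sum>k\<in>I. C i k * b d k)"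
        using C[OF u i] by (simp add: sum.distrib sum_distrib_left)
      finally show ?thesis by (simp add: vu[OF i] r_def algebra_simps)
    qed
    then show ?thesis by blast
  qed
  show ?case
  proof (cases "\<exists>j\<in>{1..n}. r j \<noteq> 0")
    case False
    then have "\<forall>v\<in>combinations n (Suc d) b. \<forall>i\<in>{1..n}. v i = (\<Sum>k\<in>I. C i k * v k)"
      using split by fastforce
    then show ?thesis using I by (intro exI[of _ I] exI[of _ C]) auto
  next
    case True
    then obtain j where j: "j \<in> {1..n}" "r j \<noteq> 0" by blast
    define s where "s i = r i / r j" for i
    \<comment> \<open>The coefficient of the new generator is read off at \<open>j\<close>. Both summands contribute at \<open>k = j\<close>
      if \<open>j\<close> is one of the old points.\<close>
    define D where "D i k = (if k \<in> I then C i k - s i * C j k else 0) + (if k = j then s i else 0)" for i k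
    have "v i = (\<Sum>k\<in>insert j I. D i k * v k)"
      if v: "v \<in> combinations n (Suc d) b" and i: "i \<in> {1..n}" for v i
    proof -
      obtain t where t: "\<And>i. i \<in> {1..n} \<Longrightarrow> v i - (\<Sum>k\<in>I. C i k * v k) = t * r i"
        using split[OF v] by blast
      have "v i - (\<Sum>k\<in>I. C i k * v k) = s i * (v j - (\<Sum>k\<in>I. C j k * v k))"
        using j by (simp add: t[OF i] t[OF j(1)] s_def)
      moreover have "(\<Sum>k\<in>insert j I. D i k * v k) =
          (\<Sum>k\<in>insert j I. if k \<in> I then (C i k - s i * C j k) * v k else 0) +
          (\<Sum>k\<in>insert j I. if k = j then s i * v k else 0)"
        unfolding sum.distrib[symmetric] by (intro sum.cong refl) (auto simp: D_def algebra_simps)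
      moreover have "(\<Sum>k\<in>insert j I. if k \<in> I then (C i k - s i * C j k) * v k else 0) =
          (\<Sum>k\<in>I. (C i k - s i * C j k) * v k)"
        using fin by (intro sum.mono_neutral_cong_right) auto
      moreover have "(\<Sum>k\<in>insert j I. if k = j then s i * v k else 0) = s i * v j"
        using fin by (subst sum.delta) auto
      moreover have "(\<Sum>k\<in>I. (C i k - s i * C j k) * v k) =
          (\<Sum>k\<in>I. C i k * v k) - s i * (\<Sum>k\<in>I. C j k * v k)"
        by (simp add: left_diff_distrib sum_subtractf sum_distrib_left mult.assoc)
      ultimately show ?thesis by (simp add: algebra_simps)
    qed
    moreover have "card (insert j I) \<le> Suc d"
      using I(2) fin by (simp add: card_insert_if)
    ultimately show ?thesis
      using I(1) j(1) by (intro exI[of _ "insert j I"] exI[of _ D]) auto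
  qed
qed

lemma avg_norm_le_interpolation_values:
  obtains I K where "I \<subseteq> {1..n}" "card I \<le> d" "0 < K"
    "\<And>v s. v \<in> combinations n d b \<Longrightarrow> 0 \<le> s \<Longrightarrow> (\<And>k. k \<in> I \<Longrightarrow> \<bar>v k\<bar> \<le> s) \<Longrightarrow> avg_norm n v \<le> K * s"
proof -
  obtain I C where I: "I \<subseteq> {1..n}" "card I \<le> d"
    and C: "\<And>v i. v \<in> combinations n d b \<Longrightarrow> i \<in> {1..n} \<Longrightarrow> v i = (\<Sum>k\<in>I. C i k * v k)"
    using interpolation_points[of n d b] by blast
  define K where "K = (\<Sum>i=1..n. \<Sum>k\<in>I. \<bar>C i k\<bar>) / real n + 1"
  have K: "0 < K"
    unfolding K_def by (intro add_nonneg_pos divide_nonneg_nonneg sum_nonneg) auto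
  have "avg_norm n v \<le> K * s"
    if v: "v \<in> combinations n d b" and s: "0 \<le> s" "\<And>k. k \<in> I \<Longrightarrow> \<bar>v k\<bar> \<le> s" for v s
  proof -
    have "(\<Sum>i=1..n. \<bar>v i\<bar>) \<le> (\<Sum>i=1..n. \<Sum>k\<in>I. \<bar>C i k\<bar> * s)"
    proof (rule sum_mono)
      fix i assume i: "i \<in> {1..n}"
      have "\<bar>v i\<bar> \<le> (\<Sum>k\<in>I. \<bar>C i k * v k\<bar>)"
        unfolding C[OF v i] by (rule sum_abs)
      also have "\<dots> \<le> (\<Sum>k\<in>I. \<bar>C i k\<bar> * s)"
        using s by (intro sum_mono) (simp add: abs_mult mult_left_mono)
      finally show "\<bar>v i\<bar> \<le> (\<Sum>k\<in>I. \<bar>C i k\<bar> * s)" .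
    qed
    also have "\<dots> = (\<Sum>i=1..n. \<Sum>k\<in>I. \<bar>C i k\<bar>) * s"
      by (simp add: sum_distrib_right)
    finally have "avg_norm n v \<le> (\<Sum>i=1..n. \<Sum>k\<in>I. \<bar>C i k\<bar>) * s / real n"
      unfolding avg_norm_def by (rule divide_right_mono) simp
    also have "\<dots> \<le> K * s"
      using s(1) by (simp add: K_def distrib_right)
    finally show ?thesis .
  qed
  with I K show ?thesis by (rule that)
qed

definition separated :: "nat \<Rightarrow> real \<Rightarrow> (nat \<Rightarrow> real) set \<Rightarrow> bool" where
  "separated n s T \<longleftrightarrow> (\<forall>u\<in>T. \<forall>v\<in>T. u \<noteq> v \<longrightarrow> s < avg_norm n (\<lambda>i. u i - v i))"

definition combinations_ball :: "nat \<Rightarrow> nat \<Rightarrow> (nat \<Rightarrow> nat \<Rightarrow> real) \<Rightarrow> real \<Rightarrow> (nat \<Rightarrow> real) set" where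
  "combinations_ball n d b r = {v \<in> combinations n d b. avg_norm n v \<le> r}"

text \<open>Pigeonhole on the rounded values at the interpolation points. The constant \<open>B\<close> may depend on
  everything except the separation \<open>s\<close> and the set \<open>T\<close>; only the exponent matters.\<close>

lemma crude_packing_bound:
  assumes r: "0 \<le> r"
  obtains B where "0 < B"
    "\<And>s T. 0 < s \<Longrightarrow> s \<le> 1 \<Longrightarrow> T \<subseteq> combinations_ball n d b r \<Longrightarrow> separated n s T \<Longrightarrow>
       finite T \<and> real (card T) \<le> (B / s) ^ d"
proof -
  obtain I K where I: "I \<subseteq> {1..n}" "card I \<le> d" and K: "0 < K" and
    dom: "\<And>v s. v \<in> combinations n d b \<Longrightarrow> 0 \<le> s \<Longrightarrow> (\<And>k. k \<in> I \<Longrightarrow> \<bar>v k\<bar> \<le> s) \<Longrightarrow> avg_norm n v \<le> K * s"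
    using avg_norm_le_interpolation_values[of n d b] by metis
  have fin: "finite I" using I(1) finite_subset by blast
  define A where "A = real n * r"
  have A: "0 \<le> A" using r by (simp add: A_def)
  \<comment> \<open>Each rounded value is an integer between \<open>- z\<close> and \<open>z\<close>, where \<open>z \<le> A * K / s + 2\<close>; this leaves at
    most \<open>2 * A * K / s + 5 \<le> B / s\<close> of them.\<close>
  define B where "B = 2 * A * K + 5"
  have "0 < B" using A K by (simp add: B_def add_nonneg_pos)
  moreover have "finite T \<and> real (card T) \<le> (B / s) ^ d"
    if s: "0 < s" "s \<le> 1" and T: "T \<subseteq> combinations_ball n d b r" and sep: "separated n s T" for s T
  proof -
    define z where "z = \<lceil>A * K / s\<rceil> + 1"
    have z0: "0 \<le> A * K / s" using A K s by simp
    have z: "0 < z" using z0 by (simp add: z_def add_nonneg_pos)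
    define F where "F v = restrict (\<lambda>k. \<lfloor>v k * K / s\<rfloor>) I" for v :: "nat \<Rightarrow> real"
    have range: "F ` T \<subseteq> (\<Pi>\<^sub>E k\<in>I. {-z..z})"
    proof (clarsimp simp: F_def)
      fix v k assume v: "v \<in> T" and k: "k \<in> I"
      have "\<bar>v k\<bar> \<le> real n * avg_norm n v" using k I(1) by (intro abs_le_avg_norm) auto
      also have "\<dots> \<le> A" using v T by (auto simp: A_def combinations_ball_def intro!: mult_left_mono)
      finally have "\<bar>v k * K / s\<bar> \<le> A * K / s"
        using K s by (simp add: abs_mult divide_right_mono mult_right_mono)
      then show "- z \<le> \<lfloor>v k * K / s\<rfloor> \<and> \<lfloor>v k * K / s\<rfloor> \<le> z"
        unfolding z_def by linarith
    qed
    have inj: "inj_on F T"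
    proof (rule inj_onI, rule ccontr)
      fix u v assume uv: "u \<in> T" "v \<in> T" "F u = F v" "u \<noteq> v"
      have "\<bar>u k - v k\<bar> \<le> s / K" if "k \<in> I" for k
      proof -
        have "\<lfloor>u k * K / s\<rfloor> = \<lfloor>v k * K / s\<rfloor>"
          using fun_cong[OF uv(3), of k] that by (simp add: F_def)
        then have "\<bar>u k * K / s - v k * K / s\<bar> \<le> 1" by linarith
        also have "u k * K / s - v k * K / s = (u k - v k) / (s / K)"
          by (simp add: left_diff_distrib diff_divide_distrib)
        finally have "\<bar>u k - v k\<bar> / (s / K) \<le> 1" using s K by (simp add: abs_divide)
        then show ?thesis using s K by (simp only: divide_le_eq_1_pos divide_pos_pos)
      qed
      moreover have "(\<lambda>i. u i - v i) \<in> combinations n d b"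
        using combinations_add_scaled[of u n d b v "-1"] uv T by (auto simp: combinations_ball_def)
      ultimately have "avg_norm n (\<lambda>i. u i - v i) \<le> K * (s / K)"
        using s K by (intro dom) auto
      then show False using sep uv(1,2,4) K unfolding separated_def by fastforce
    qed
    have finP: "finite (\<Pi>\<^sub>E k\<in>I. {-z..z})" using fin by (intro finite_PiE) auto
    have finT: "finite T" using inj range finP by (meson finite_imageD finite_subset)
    have "card T = card (F ` T)" using inj by (simp add: card_image)
    also have "\<dots> \<le> card (\<Pi>\<^sub>E k\<in>I. {-z..z})" by (intro card_mono finP range)
    also have "\<dots> = nat (2 * z + 1) ^ card I"
      using fin by (simp add: card_PiE)
    finally have "real (card T) \<le> real_of_int (2 * z + 1) ^ card I"
      using z by (metis (mono_tags) add_nonneg_pos of_nat_le_iff of_nat_power of_nat_nat less_imp_le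
        mult_nonneg_nonneg zero_le_numeral zero_less_one)
    also have "\<dots> \<le> real_of_int (2 * z + 1) ^ d"
      using z by (intro power_increasing I(2)) auto
    also have "\<dots> \<le> (B / s) ^ d"
    proof (rule power_mono)
      have "real_of_int z \<le> A * K / s + 2" unfolding z_def by linarith
      then have "real_of_int (2 * z + 1) \<le> 2 * (A * K / s) + 5" by simp
      also have "5 \<le> 5 / s" using s by (simp add: field_simps)
      finally show "real_of_int (2 * z + 1) \<le> B / s"
        by (simp add: B_def add_divide_distrib mult.assoc)
    qed (use z in simp)
    finally show ?thesis using finT by simp
  qed
  ultimately show ?thesis by (rule that)
qed

text \<open>The set \<open>T\<close> consists of the base-\<open>k\<close> expansions \<open>p\<^sub>0 + p\<^sub>1 / k + p\<^sub>2 / k\<^sup>2 + \<dots>\<close> of length \<open>J\<close> with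
  digits in \<open>S\<close>. Two digits differ by more than \<open>\<delta>\<close>, whereas the tails behind them differ by at most
  \<open>4 * c / k \<le> \<delta> / 2\<close>, so a difference in one digit is never compensated by later ones.\<close>

lemma separated_expansions:
  assumes S: "S \<subseteq> combinations_ball n d b c" "finite S" "separated n \<delta> S"
    and c: "0 < c" and \<delta>: "0 < \<delta>" "\<delta> \<le> c" and k: "8 * c / \<delta> \<le> real k"
  shows "\<exists>T. T \<subseteq> combinations_ball n d b (2 * c) \<and> finite T \<and> card T = card S ^ J \<and>
     separated n (\<delta> / 2 / real k ^ J) T"
proof (induction J)
  case 0
  have "{\<lambda>_. 0} \<subseteq> combinations_ball n d b (2 * c)"
    using c combinations_zero by (auto simp: combinations_ball_def avg_norm_def)
  then show ?case by (intro exI[of _ "{\<lambda>_. 0}"]) (auto simp: separated_def)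
next
  case (Suc J)
  have k8: "8 * c \<le> real k * \<delta>" using k \<delta> by (simp add: field_simps)
  have "8 * \<delta> \<le> real k * \<delta>" using k8 \<delta> by linarith
  then have kpos: "8 \<le> real k" using \<delta> by simp
  obtain T where T: "T \<subseteq> combinations_ball n d b (2 * c)" "finite T" "card T = card S ^ J"
      "separated n (\<delta> / 2 / real k ^ J) T"
    using Suc.IH by blast
  define f :: "(nat \<Rightarrow> real) \<times> (nat \<Rightarrow> real) \<Rightarrow> nat \<Rightarrow> real"
    where "f = (\<lambda>(p, t) i. p i + (1 / real k) * t i)"
  have sep: "\<delta> / 2 / real k ^ Suc J < avg_norm n (\<lambda>i. f (p, t) i - f (p', t') i)"
    if "p \<in> S" "p' \<in> S" "t \<in> T" "t' \<in> T" "(p, t) \<noteq> (p', t')" for p p' t t'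
  proof (cases "p = p'")
    case True
    then have "avg_norm n (\<lambda>i. f (p, t) i - f (p', t') i) =
        avg_norm n (\<lambda>i. (1 / real k) * (t i - t' i))"
      by (intro avg_norm_cong) (simp add: f_def right_diff_distrib)
    also have "\<dots> = avg_norm n (\<lambda>i. t i - t' i) / real k"
      by (subst avg_norm_scale) simp
    finally have eq: "avg_norm n (\<lambda>i. f (p, t) i - f (p', t') i) = avg_norm n (\<lambda>i. t i - t' i) / real k" .
    have "\<delta> / 2 / real k ^ J < avg_norm n (\<lambda>i. t i - t' i)"
      using T(4) that True unfolding separated_def by blast
    then have "\<delta> / 2 / real k ^ J / real k < avg_norm n (\<lambda>i. t i - t' i) / real k"
      using kpos by (intro divide_strict_right_mono) auto
    then show ?thesis by (simp add: eq mult.commute)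
  next
    case False
    have "\<delta> < avg_norm n (\<lambda>i. p i - p' i)"
      using S(3) that False unfolding separated_def by blast
    also have "\<dots> \<le> avg_norm n (\<lambda>i. f (p, t) i - f (p', t') i) +
        avg_norm n (\<lambda>i. (1 / real k) * (t i - t' i))"
      by (rule avg_norm_triangle) (simp add: f_def right_diff_distrib)
    also have "avg_norm n (\<lambda>i. (1 / real k) * (t i - t' i)) = avg_norm n (\<lambda>i. t i - t' i) / real k"
      by (subst avg_norm_scale) simp
    also have "avg_norm n (\<lambda>i. t i - t' i) / real k \<le> 4 * c / real k"
    proof (rule divide_right_mono)
      have "avg_norm n (\<lambda>i. t i - t' i) \<le> avg_norm n t + avg_norm n t'"
        by (rule avg_norm_triangle) simp
      also have "\<dots> \<le> 2 * c + 2 * c"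
        using T(1) that by (intro add_mono) (auto simp: combinations_ball_def)
      finally show "avg_norm n (\<lambda>i. t i - t' i) \<le> 4 * c" by simp
    qed simp
    also have "4 * c / real k \<le> \<delta> / 2" using k8 kpos by (simp add: field_simps)
    finally have "\<delta> / 2 < avg_norm n (\<lambda>i. f (p, t) i - f (p', t') i)" by simp
    moreover have "\<delta> / 2 / real k ^ Suc J \<le> \<delta> / 2"
    proof -
      have "1 \<le> real k ^ Suc J" using kpos by (intro one_le_power) simp
      then have "\<delta> * 1 \<le> \<delta> * real k ^ Suc J" using \<delta> by (intro mult_left_mono) auto
      then show ?thesis using kpos by (simp add: divide_le_eq)
    qed
    ultimately show ?thesis by linarith
  qed
  have inj: "inj_on f (S \<times> T)"
  proof (rule inj_onI, rule ccontr)
    fix y z assume yz: "y \<in> S \<times> T" "z \<in> S \<times> T" "f y = f z" "y \<noteq> z"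
    have "\<delta> / 2 / real k ^ Suc J < avg_norm n (\<lambda>i. f y i - f z i)"
      using sep[of "fst y" "fst z" "snd y" "snd z"] yz by auto
    moreover have "0 \<le> \<delta> / 2 / real k ^ Suc J" using \<delta> by simp
    ultimately show False using yz(3) by (simp add: avg_norm_def)
  qed
  have "f ` (S \<times> T) \<subseteq> combinations_ball n d b (2 * c)"
  proof (clarify)
    fix p t assume pt: "p \<in> S" "t \<in> T"
    have "avg_norm n (f (p, t)) \<le> avg_norm n p + avg_norm n (\<lambda>i. (1 / real k) * t i)"
    proof (rule avg_norm_triangle)
      fix i show "\<bar>f (p, t) i\<bar> \<le> \<bar>p i\<bar> + \<bar>(1 / real k) * t i\<bar>"
        unfolding f_def prod.case by (rule abs_triangle_ineq)
    qed
    also have "\<dots> = avg_norm n p + avg_norm n t / real k"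
      by (subst avg_norm_scale) simp
    also have "\<dots> \<le> c + 2 * c / real k"
      using pt S(1) T(1) by (intro add_mono divide_right_mono) (auto simp: combinations_ball_def)
    also have "\<dots> \<le> 2 * c" using kpos c by (simp add: field_simps)
    finally show "f (p, t) \<in> combinations_ball n d b (2 * c)"
      using combinations_add_scaled[of p n d b t "1 / real k"] pt S(1) T(1)
      by (auto simp: combinations_ball_def f_def)
  qed
  moreover have "separated n (\<delta> / 2 / real k ^ Suc J) (f ` (S \<times> T))"
    unfolding separated_def
  proof (intro ballI impI)
    fix u v assume uv: "u \<in> f ` (S \<times> T)" "v \<in> f ` (S \<times> T)" "u \<noteq> v"
    obtain p t where 1: "u = f (p, t)" "p \<in> S" "t \<in> T" using uv(1) by blast
    obtain p' t' where 2: "v = f (p', t')" "p' \<in> S" "t' \<in> T" using uv(2) by blast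
    have "(p, t) \<noteq> (p', t')" using uv(3) 1(1) 2(1) by blast
    then show "\<delta> / 2 / real k ^ Suc J < avg_norm n (\<lambda>i. u i - v i)"
      unfolding 1(1) 2(1) by (rule sep[OF 1(2) 2(2) 1(3) 2(3)])
  qed
  moreover have "card (f ` (S \<times> T)) = card S ^ Suc J"
    by (simp add: card_image[OF inj] card_cartesian_product T(3))
  ultimately show ?case using S(2) T(2) by (intro exI[of _ "f ` (S \<times> T)"]) auto
qed

lemma le_of_powers_bounded:
  fixes a N C :: real
  assumes "0 < a" and bd: "\<And>J. N ^ J \<le> C * a ^ J"
  shows "N \<le> a"
proof (rule ccontr)
  assume "\<not> N \<le> a"
  then have "1 < N / a" using assms by simp
  then obtain J where "C < (N / a) ^ J" using real_arch_pow by blast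
  then show False using bd[of J] assms by (simp add: power_divide field_simps)
qed

text \<open>The bound has no constant in front of \<open>k ^ d\<close>. A volume comparison would give it as well; here
  the crude bound is applied to the \<open>card S ^ J\<close> expansions of length \<open>J\<close>, and its constant
  disappears when the \<open>J\<close>-th root is taken and \<open>J\<close> tends to infinity.\<close>

lemma packing_bound:
  assumes S: "S \<subseteq> combinations_ball n d b c" "separated n \<delta> S"
    and c: "0 < c" and \<delta>: "0 < \<delta>" "\<delta> \<le> c" "\<delta> \<le> 1" and k: "8 * c / \<delta> \<le> real k"
  shows "finite S \<and> card S \<le> k ^ d"
proof -
  have "8 * c \<le> real k * \<delta>" using k \<delta> by (simp add: field_simps)
  then have "8 * \<delta> \<le> real k * \<delta>" using \<delta> by linarith
  then have kpos: "8 \<le> real k" using \<delta> by simp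
  have "0 \<le> 2 * c" using c by simp
  then obtain B where B: "0 < B"
      "\<And>s T. 0 < s \<Longrightarrow> s \<le> 1 \<Longrightarrow> T \<subseteq> combinations_ball n d b (2 * c) \<Longrightarrow> separated n s T \<Longrightarrow>
       finite T \<and> real (card T) \<le> (B / s) ^ d"
    using crude_packing_bound[of "2 * c" n d b] by blast
  have "combinations_ball n d b c \<subseteq> combinations_ball n d b (2 * c)"
    using c by (auto simp: combinations_ball_def)
  then have fin: "finite S" using B(2)[of \<delta> S] S \<delta> by auto
  have "real (card S) ^ J \<le> (B / (\<delta> / 2)) ^ d * (real k ^ d) ^ J" for J
  proof -
    obtain T where T: "T \<subseteq> combinations_ball n d b (2 * c)" "finite T" "card T = card S ^ J"
        "separated n (\<delta> / 2 / real k ^ J) T"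
      using separated_expansions[OF S(1) fin S(2) c \<delta>(1,2) k] by blast
    have "1 \<le> real k ^ J" using kpos by (intro one_le_power) simp
    then have "\<delta> / 2 / real k ^ J \<le> 1" 
      using \<delta> mult_mono[of "\<delta> / 2" 1 1 "real k ^ J"] by (simp add: divide_le_eq)
    moreover have "0 < \<delta> / 2 / real k ^ J" using \<delta> kpos by simp
    ultimately have "real (card T) \<le> (B / (\<delta> / 2 / real k ^ J)) ^ d"
      using B(2)[OF _ _ T(1,4)] by simp
    also have "B / (\<delta> / 2 / real k ^ J) = B / (\<delta> / 2) * real k ^ J" by simp
    finally show ?thesis
      unfolding T(3) power_mult_distrib of_nat_power by (simp only: power_mult[symmetric] mult.commute[of J d])
  qed
  moreover have "0 < real k ^ d" using kpos by simp
  ultimately have "real (card S) \<le> real k ^ d"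
    by (rule le_of_powers_bounded[rotated])
  then have "card S \<le> k ^ d" by (metis of_nat_le_iff of_nat_power)
  with fin show ?thesis by blast
qed

text \<open>A maximal separated set is a net.\<close>

lemma ball_covering:
  assumes c: "0 < c" and \<delta>: "0 < \<delta>" "\<delta> \<le> c" "\<delta> \<le> 1" and k: "8 * c / \<delta> \<le> real k"
  obtains S where "S \<subseteq> combinations_ball n d b c" "finite S" "card S \<le> k ^ d"
    "\<And>v. v \<in> combinations_ball n d b c \<Longrightarrow> \<exists>u\<in>S. avg_norm n (\<lambda>i. v i - u i) \<le> \<delta>"
proof -
  define P where "P S \<longleftrightarrow> S \<subseteq> combinations_ball n d b c \<and> separated n \<delta> S" for S
  have bd: "finite S \<and> card S \<le> k ^ d" if "P S" for S
    using packing_bound[OF _ _ c \<delta> k] that by (auto simp: P_def)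
  have "P {}" by (simp add: P_def separated_def)
  then obtain S where S: "P S" and max: "\<And>T. P T \<Longrightarrow> card T \<le> card S"
    using ex_has_greatest_nat[of P "{}" card "Suc (k ^ d)"] bd by (auto simp: less_Suc_eq_le)
  have "\<exists>u\<in>S. avg_norm n (\<lambda>i. v i - u i) \<le> \<delta>" if v: "v \<in> combinations_ball n d b c" for v
  proof (rule ccontr)
    assume "\<not> ?thesis"
    then have far: "\<And>u. u \<in> S \<Longrightarrow> \<delta> < avg_norm n (\<lambda>i. v i - u i)" by (meson not_le)
    moreover have "\<And>u. avg_norm n (\<lambda>i. u i - v i) = avg_norm n (\<lambda>i. v i - u i)"
      by (rule avg_norm_cong) (simp add: abs_minus_commute)
    ultimately have "P (insert v S)"
      using S v by (auto simp: P_def separated_def)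
    then have "card (insert v S) \<le> card S" by (rule max)
    then have "v \<in> S" using bd[OF S] by (simp add: card_insert_if split: if_splits)
    then show False using far[of v] \<delta> by (simp add: avg_norm_def)
  qed
  then show ?thesis using that S bd[OF S] by (auto simp: P_def)
qed


section \<open>Deviations of the residual distribution\<close>

lemma BL_functionsD:
  assumes "h \<in> BL_functions"
  shows "\<bar>h x\<bar> \<le> 1" "\<bar>h x - h y\<bar> \<le> \<bar>x - y\<bar>"
proof -
  have "h x \<in> {-1..1}" "\<bar>h x - h y\<bar> \<le> \<bar>x - y\<bar>"
    using assms by (auto simp: BL_functions_def)
  then show "\<bar>h x\<bar> \<le> 1" "\<bar>h x - h y\<bar> \<le> \<bar>x - y\<bar>" by auto
qed

lemma zero_BL_function: "(\<lambda>_. 0) \<in> BL_functions"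
  by (simp add: BL_functions_def)

lemma BL_functions_nonempty: "BL_functions \<noteq> {}"
  using zero_BL_function by blast

lemma BL_function_measurable:
  assumes "h \<in> BL_functions"
  shows "h \<in> borel_measurable borel"
proof (rule borel_measurable_continuous_onI)
  have "1-lipschitz_on UNIV h"
    using BL_functionsD(2)[OF assms] by (intro lipschitz_onI) (auto simp: dist_real_def)
  then show "continuous_on UNIV h" by (rule lipschitz_on_continuous_on)
qed

lemma BL_function_integrable:
  assumes "h \<in> BL_functions" "real_distribution P"
  shows "integrable P (\<lambda>y. h (y - a))"
proof -
  interpret P: real_distribution P by (rule assms)
  note [measurable] = BL_function_measurable[OF assms(1)]
  show ?thesis
    using BL_functionsD(1)[OF assms(1)] by (intro P.integrable_const_bound[where B=1]) auto
qed

text \<open>A finite net on a compact interval suffices, because outside of it the trivial bound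
  \<open>\<bar>h r - g r\<bar> \<le> 2\<close> is at most \<open>2 * \<bar>r\<bar> / K\<close>, which averages to a first moment.\<close>

lemma BL_functions_finite_net:
  assumes K: "0 < K" and \<delta>: "0 < \<delta>"
  obtains H where "H \<subseteq> BL_functions" "finite H"
    "\<And>h. h \<in> BL_functions \<Longrightarrow> \<exists>g\<in>H. \<forall>r. \<bar>h r - g r\<bar> \<le> \<delta> + 2 / K * \<bar>r\<bar>"
proof -
  \<comment> \<open>Arguments and values are rounded to the grid of mesh \<open>s\<close>. Functions with the same rounded values
    differ by at most \<open>s\<close> on the grid points, and each adds another \<open>s\<close> between them.\<close>
  define s where "s = \<delta> / 3"
  have s: "0 < s" using \<delta> by (simp add: s_def)
  define J where "J = \<lceil>K / s\<rceil>"
  define z where "z = \<lceil>1 / s\<rceil> + 1"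
  define F where "F h = restrict (\<lambda>j. \<lfloor>h (of_int j * s) / s\<rfloor>) {-J..J}" for h :: "real \<Rightarrow> real"
  have "F ` BL_functions \<subseteq> (\<Pi>\<^sub>E j\<in>{-J..J}. {-z..z})"
  proof (clarsimp simp: F_def)
    fix h j assume h: "h \<in> BL_functions"
    have "\<bar>h (of_int j * s) / s\<bar> \<le> 1 / s"
      using BL_functionsD(1)[OF h] s by (simp add: divide_right_mono)
    then show "- z \<le> \<lfloor>h (of_int j * s) / s\<rfloor> \<and> \<lfloor>h (of_int j * s) / s\<rfloor> \<le> z"
      unfolding z_def by linarith
  qed
  then have "finite (F ` BL_functions)"
    by (rule finite_subset) (intro finite_PiE, auto)
  then obtain H where H: "H \<subseteq> BL_functions" "finite H" "F ` BL_functions = F ` H"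
    using finite_subset_image[of "F ` BL_functions" F BL_functions] by blast
  have "\<exists>g\<in>H. \<forall>r. \<bar>h r - g r\<bar> \<le> \<delta> + 2 / K * \<bar>r\<bar>" if h: "h \<in> BL_functions" for h
  proof -
    obtain g where g: "g \<in> H" "F h = F g" using H(3) h by blast
    have gB: "g \<in> BL_functions" using g(1) H(1) by blast
    have "\<bar>h r - g r\<bar> \<le> \<delta> + 2 / K * \<bar>r\<bar>" for r
    proof (cases "\<bar>r\<bar> \<le> K")
      case True
      define j where "j = \<lfloor>r / s\<rfloor>"
      have "\<bar>r / s\<bar> \<le> K / s" using True s by (simp add: divide_right_mono)
      then have j: "j \<in> {-J..J}" unfolding j_def J_def by (auto; linarith)
      have "\<lfloor>h (of_int j * s) / s\<rfloor> = \<lfloor>g (of_int j * s) / s\<rfloor>"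
        using fun_cong[OF g(2), of j] j by (simp add: F_def)
      then have "\<bar>h (of_int j * s) / s - g (of_int j * s) / s\<bar> \<le> 1" by linarith
      then have "\<bar>h (of_int j * s) - g (of_int j * s)\<bar> / s \<le> 1"
        using s by (simp add: abs_divide flip: diff_divide_distrib)
      then have 1: "\<bar>h (of_int j * s) - g (of_int j * s)\<bar> \<le> s" using s by simp
      have "\<bar>r / s - of_int j\<bar> \<le> 1" unfolding j_def by linarith
      also have "r / s - of_int j = (r - of_int j * s) / s" using s by (simp add: field_simps)
      finally have 2: "\<bar>r - of_int j * s\<bar> \<le> s" using s by (simp add: abs_divide)
      have "\<bar>h r - h (of_int j * s)\<bar> \<le> s" "\<bar>g r - g (of_int j * s)\<bar> \<le> s"
        using BL_functionsD(2)[OF h] BL_functionsD(2)[OF gB] 2 by (meson order_trans)+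
      with 1 have "\<bar>h r - g r\<bar> \<le> 3 * s" by linarith
      moreover have "0 \<le> 2 / K * \<bar>r\<bar>" using K by simp
      ultimately show ?thesis by (simp add: s_def)
    next
      case False
      then have "2 \<le> 2 / K * \<bar>r\<bar>" using K by (simp add: field_simps)
      moreover have "\<bar>h r - g r\<bar> \<le> 2"
        using BL_functionsD(1)[OF h, of r] BL_functionsD(1)[OF gB, of r] by linarith
      ultimately show ?thesis using \<delta> by linarith
    qed
    then show ?thesis using g(1) by blast
  qed
  with H(1,2) show ?thesis by (rule that)
qed

definition deviation ::
    "nat \<Rightarrow> real measure \<Rightarrow> (real \<Rightarrow> real) \<Rightarrow> (nat \<Rightarrow> real) \<Rightarrow> (nat \<Rightarrow> real) \<Rightarrow> real" where
  "deviation n P h v e = (\<Sum>i=1..n. h (e i - v i) - (\<integral>y. h (y - v i) \<partial>P)) / real n"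

definition BL_deviation ::
    "nat \<Rightarrow> real measure \<Rightarrow> (nat \<Rightarrow> real) \<Rightarrow> (nat \<Rightarrow> real) \<Rightarrow> real" where
  "BL_deviation n P v e = (SUP h\<in>BL_functions. \<bar>deviation n P h v e\<bar>)"

text \<open>The same estimate serves for moving \<open>e\<close> and \<open>v\<close> with a fixed test function and for replacing the
  test function with \<open>e\<close> and \<open>v\<close> fixed.\<close>

lemma deviation_perturb:
  assumes "\<And>i. i \<in> {1..n} \<Longrightarrow> \<bar>h (e i - v i) - g (e' i - v' i)\<bar> \<le> A i"
    and "\<And>i. i \<in> {1..n} \<Longrightarrow> \<bar>(\<integral>y. h (y - v i) \<partial>P) - (\<integral>y. g (y - v' i) \<partial>P)\<bar> \<le> B i"
  shows "\<bar>deviation n P h v e\<bar> \<le> \<bar>deviation n P g v' e'\<bar> + (\<Sum>i=1..n. A i + B i) / real n"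
proof -
  let ?x = "\<lambda>i. h (e i - v i) - (\<integral>y. h (y - v i) \<partial>P)"
  let ?y = "\<lambda>i. g (e' i - v' i) - (\<integral>y. g (y - v' i) \<partial>P)"
  have "\<bar>(\<Sum>i=1..n. ?x i) - (\<Sum>i=1..n. ?y i)\<bar> \<le> (\<Sum>i=1..n. A i + B i)"
    unfolding sum_subtractf[symmetric]
  proof (rule sum_abs[THEN order_trans], rule sum_mono)
    fix i assume "i \<in> {1..n}"
    from assms(1)[OF this] assms(2)[OF this] show "\<bar>?x i - ?y i\<bar> \<le> A i + B i" by linarith
  qed
  then have "\<bar>\<Sum>i=1..n. ?x i\<bar> \<le> \<bar>\<Sum>i=1..n. ?y i\<bar> + (\<Sum>i=1..n. A i + B i)" by linarith
  then have "\<bar>\<Sum>i=1..n. ?x i\<bar> / real n \<le> (\<bar>\<Sum>i=1..n. ?y i\<bar> + (\<Sum>i=1..n. A i + B i)) / real n"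
    by (rule divide_right_mono) simp
  then show ?thesis by (simp add: deviation_def abs_divide add_divide_distrib)
qed

lemma integral_diff_abs_le:
  fixes f g w :: "real \<Rightarrow> real"
  assumes "integrable P f" "integrable P g" "integrable P w" "\<And>y. \<bar>f y - g y\<bar> \<le> w y"
  shows "\<bar>(\<integral>y. f y \<partial>P) - (\<integral>y. g y \<partial>P)\<bar> \<le> (\<integral>y. w y \<partial>P)"
proof -
  have "\<bar>(\<integral>y. f y \<partial>P) - (\<integral>y. g y \<partial>P)\<bar> = \<bar>\<integral>y. f y - g y \<partial>P\<bar>" using assms by simp
  also have "\<dots> \<le> (\<integral>y. \<bar>f y - g y\<bar> \<partial>P)" by (rule integral_abs_bound)
  also have "\<dots> \<le> (\<integral>y. w y \<partial>P)" using assms by (intro integral_mono) auto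
  finally show ?thesis .
qed

lemma deviation_lipschitz:
  assumes h: "h \<in> BL_functions" and P: "real_distribution P"
  shows "\<bar>deviation n P h v e\<bar> \<le> \<bar>deviation n P h v' e'\<bar> +
    (avg_norm n (\<lambda>i. e i - e' i) + 2 * avg_norm n (\<lambda>i. v i - v' i))"
proof -
  interpret P: real_distribution P by (rule P)
  have "\<bar>deviation n P h v e\<bar> \<le> \<bar>deviation n P h v' e'\<bar> +
     (\<Sum>i=1..n. (\<bar>e i - e' i\<bar> + \<bar>v i - v' i\<bar>) + \<bar>v i - v' i\<bar>) / real n"
  proof (rule deviation_perturb)
    fix i
    have "\<bar>h (e i - v i) - h (e' i - v' i)\<bar> \<le> \<bar>(e i - v i) - (e' i - v' i)\<bar>"
      by (rule BL_functionsD(2)[OF h])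
    then show "\<bar>h (e i - v i) - h (e' i - v' i)\<bar> \<le> \<bar>e i - e' i\<bar> + \<bar>v i - v' i\<bar>" by linarith
    have "\<bar>(\<integral>y. h (y - v i) \<partial>P) - (\<integral>y. h (y - v' i) \<partial>P)\<bar> \<le> (\<integral>y. \<bar>v i - v' i\<bar> \<partial>P)"
    proof (rule integral_diff_abs_le)
      fix y show "\<bar>h (y - v i) - h (y - v' i)\<bar> \<le> \<bar>v i - v' i\<bar>"
        using BL_functionsD(2)[OF h, of "y - v i" "y - v' i"] by linarith
    qed (simp_all add: BL_function_integrable[OF h P])
    then show "\<bar>(\<integral>y. h (y - v i) \<partial>P) - (\<integral>y. h (y - v' i) \<partial>P)\<bar> \<le> \<bar>v i - v' i\<bar>"
      by (simp add: P.prob_space[simplified])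
  qed
  also have "(\<Sum>i=1..n. (\<bar>e i - e' i\<bar> + \<bar>v i - v' i\<bar>) + \<bar>v i - v' i\<bar>) =
      (\<Sum>i=1..n. \<bar>e i - e' i\<bar>) + 2 * (\<Sum>i=1..n. \<bar>v i - v' i\<bar>)"
    by (simp add: sum.distrib flip: sum_distrib_left)
  finally show ?thesis by (simp add: avg_norm_def add_divide_distrib)
qed

lemma deviation_net:
  assumes h: "h \<in> BL_functions" and g: "g \<in> BL_functions" and P: "P \<in> integrable_distributions"
    and hg: "\<And>r. \<bar>h r - g r\<bar> \<le> \<delta> + a * \<bar>r\<bar>" and a: "0 \<le> a" and n: "0 < n"
  shows "\<bar>deviation n P h v e\<bar> \<le> \<bar>deviation n P g v e\<bar> +
    (2 * \<delta> + a * (avg_norm n e + (\<integral>y. \<bar>y\<bar> \<partial>P) + 2 * avg_norm n v))"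
proof -
  have Pd: "real_distribution P" and Pi: "integrable P (\<lambda>y. \<bar>y\<bar>)"
    using P by (auto simp: integrable_distributions_def)
  interpret P: real_distribution P by (rule Pd)
  have "\<bar>deviation n P h v e\<bar> \<le> \<bar>deviation n P g v e\<bar> +
     (\<Sum>i=1..n. (\<delta> + a * (\<bar>e i\<bar> + \<bar>v i\<bar>)) + (\<delta> + a * ((\<integral>y. \<bar>y\<bar> \<partial>P) + \<bar>v i\<bar>))) / real n"
  proof (rule deviation_perturb)
    fix i
    have *: "\<bar>h (y - v i) - g (y - v i)\<bar> \<le> \<delta> + a * (\<bar>y\<bar> + \<bar>v i\<bar>)" for y
    proof -
      have "a * \<bar>y - v i\<bar> \<le> a * (\<bar>y\<bar> + \<bar>v i\<bar>)" using a by (intro mult_left_mono) auto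
      with hg[of "y - v i"] show ?thesis by linarith
    qed
    then show "\<bar>h (e i - v i) - g (e i - v i)\<bar> \<le> \<delta> + a * (\<bar>e i\<bar> + \<bar>v i\<bar>)" .
    have "\<bar>(\<integral>y. h (y - v i) \<partial>P) - (\<integral>y. g (y - v i) \<partial>P)\<bar> \<le> (\<integral>y. \<delta> + a * (\<bar>y\<bar> + \<bar>v i\<bar>) \<partial>P)"
      using Pi by (intro integral_diff_abs_le BL_function_integrable h g Pd *) auto
    also have "\<dots> = \<delta> + a * ((\<integral>y. \<bar>y\<bar> \<partial>P) + \<bar>v i\<bar>)"
      using Pi by (simp add: P.prob_space[simplified])
    finally show "\<bar>(\<integral>y. h (y - v i) \<partial>P) - (\<integral>y. g (y - v i) \<partial>P)\<bar> \<le> \<delta> + a * ((\<integral>y. \<bar>y\<bar> \<partial>P) + \<bar>v i\<bar>)" .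
  qed
  also have "(\<Sum>i=1..n. (\<delta> + a * (\<bar>e i\<bar> + \<bar>v i\<bar>)) + (\<delta> + a * ((\<integral>y. \<bar>y\<bar> \<partial>P) + \<bar>v i\<bar>))) =
      (\<Sum>i=1..n. (2 * \<delta> + a * (\<integral>y. \<bar>y\<bar> \<partial>P)) + a * \<bar>e i\<bar> + 2 * a * \<bar>v i\<bar>)"
    by (intro sum.cong refl) (simp add: algebra_simps)
  also have "\<dots> = real n * (2 * \<delta> + a * (\<integral>y. \<bar>y\<bar> \<partial>P)) + a * (\<Sum>i=1..n. \<bar>e i\<bar>) + 2 * a * (\<Sum>i=1..n. \<bar>v i\<bar>)"
    unfolding sum.distrib by (simp add: distrib_left flip: sum_distrib_left)
  also have "\<dots> / real n = 2 * \<delta> + a * (avg_norm n e + (\<integral>y. \<bar>y\<bar> \<partial>P) + 2 * avg_norm n v)"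
    using n by (simp add: avg_norm_def add_divide_distrib distrib_left)
  finally show ?thesis .
qed

lemma abs_deviation_le_2:
  assumes h: "h \<in> BL_functions" and P: "real_distribution P"
  shows "\<bar>deviation n P h v e\<bar> \<le> 2"
proof -
  interpret P: real_distribution P by (rule P)
  have "\<bar>deviation n P h v e\<bar> \<le> \<bar>deviation n P (\<lambda>_. 0) v e\<bar> + (\<Sum>i=1..n. 1 + 1) / real n"
  proof (rule deviation_perturb)
    fix i
    show "\<bar>h (e i - v i) - 0\<bar> \<le> 1" using BL_functionsD(1)[OF h] by simp
    have "\<bar>(\<integral>y. h (y - v i) \<partial>P) - (\<integral>y. 0 \<partial>P)\<bar> \<le> (\<integral>y. 1 \<partial>P)"
      using BL_functionsD(1)[OF h]
        by (intro integral_diff_abs_le) (auto intro: BL_function_integrable h P)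
    then show "\<bar>(\<integral>y. h (y - v i) \<partial>P) - (\<integral>y. 0 \<partial>P)\<bar> \<le> 1" by (simp add: P.prob_space[simplified])
  qed
  also have "\<dots> \<le> 2" by (simp add: deviation_def)
  finally show ?thesis .
qed

lemma BL_deviation_upper:
  assumes "h \<in> BL_functions" "real_distribution P"
  shows "\<bar>deviation n P h v e\<bar> \<le> BL_deviation n P v e"
  unfolding BL_deviation_def using assms abs_deviation_le_2
  by (intro cSUP_upper bdd_aboveI2[where M=2]) auto

lemma BL_deviation_least:
  assumes "\<And>h. h \<in> BL_functions \<Longrightarrow> \<bar>deviation n P h v e\<bar> \<le> r"
  shows "BL_deviation n P v e \<le> r"
  unfolding BL_deviation_def using assms by (intro cSUP_least BL_functions_nonempty)

lemma BL_deviation_nonneg: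
  assumes "real_distribution P"
  shows "0 \<le> BL_deviation n P v e"
  using BL_deviation_upper[OF zero_BL_function assms, of n v e] by simp

lemma BL_deviation_lipschitz:
  assumes P: "real_distribution P"
  shows "BL_deviation n P v e \<le> BL_deviation n P v' e' +
    (avg_norm n (\<lambda>i. e i - e' i) + 2 * avg_norm n (\<lambda>i. v i - v' i))"
proof (rule BL_deviation_least)
  fix h assume h: "h \<in> BL_functions"
  show "\<bar>deviation n P h v e\<bar> \<le> BL_deviation n P v' e' +
      (avg_norm n (\<lambda>i. e i - e' i) + 2 * avg_norm n (\<lambda>i. v i - v' i))"
    using deviation_lipschitz[OF h P, of n v e v' e'] BL_deviation_upper[OF h P, of n v' e']
    by linarith
qed

text \<open>The coefficient 5 collects \<open>\<delta>\<close> for the deviations at the net points, \<open>2 * \<delta>\<close> for moving \<open>v\<close> to a net point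
  and \<open>2 * \<delta>\<close> for replacing the test function.\<close>

lemma BL_deviation_le_nets:
  assumes P: "P \<in> integrable_distributions" and n: "0 < n" and K: "0 < K"
    and S: "S \<subseteq> combinations_ball n d b c"
      "\<And>v. v \<in> combinations_ball n d b c \<Longrightarrow> \<exists>u\<in>S. avg_norm n (\<lambda>i. v i - u i) \<le> \<delta>"
    and H: "H \<subseteq> BL_functions"
      "\<And>h. h \<in> BL_functions \<Longrightarrow> \<exists>g\<in>H. \<forall>r. \<bar>h r - g r\<bar> \<le> \<delta> + 2 / K * \<bar>r\<bar>"
    and small: "\<And>u g. u \<in> S \<Longrightarrow> g \<in> H \<Longrightarrow> \<bar>deviation n P g u e\<bar> \<le> \<delta>"
    and v: "v \<in> combinations_ball n d b c"
  shows "BL_deviation n P v e \<le> 5 * \<delta> + 2 / K * (avg_norm n e + (\<integral>y. \<bar>y\<bar> \<partial>P) + 2 * c)"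
proof -
  have Pd: "real_distribution P" using P by (simp add: integrable_distributions_def)
  obtain u where u: "u \<in> S" "avg_norm n (\<lambda>i. v i - u i) \<le> \<delta>" using S(2)[OF v] by blast
  have cu: "avg_norm n u \<le> c" using u(1) S(1) by (auto simp: combinations_ball_def)
  have "BL_deviation n P u e \<le> 3 * \<delta> + 2 / K * (avg_norm n e + (\<integral>y. \<bar>y\<bar> \<partial>P) + 2 * c)"
  proof (rule BL_deviation_least)
    fix h assume h: "h \<in> BL_functions"
    obtain g where g: "g \<in> H" "\<And>r. \<bar>h r - g r\<bar> \<le> \<delta> + 2 / K * \<bar>r\<bar>" using H(2)[OF h] by blast
    have gB: "g \<in> BL_functions" using g(1) H(1) by blast
    have "\<bar>deviation n P h u e\<bar> \<le> \<bar>deviation n P g u e\<bar> +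
        (2 * \<delta> + 2 / K * (avg_norm n e + (\<integral>y. \<bar>y\<bar> \<partial>P) + 2 * avg_norm n u))"
      using K by (intro deviation_net h gB P g(2) n) simp
    moreover have "2 / K * (avg_norm n e + (\<integral>y. \<bar>y\<bar> \<partial>P) + 2 * avg_norm n u) \<le>
        2 / K * (avg_norm n e + (\<integral>y. \<bar>y\<bar> \<partial>P) + 2 * c)"
      using K cu by (intro mult_left_mono) auto
    ultimately show "\<bar>deviation n P h u e\<bar> \<le> 3 * \<delta> + 2 / K * (avg_norm n e + (\<integral>y. \<bar>y\<bar> \<partial>P) + 2 * c)"
      using small[OF u(1) g(1)] by linarith
  qed
  moreover have "BL_deviation n P v e \<le> BL_deviation n P u e + (avg_norm n (\<lambda>i. e i - e i) + 2 * avg_norm n (\<lambda>i. v i - u i))"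
    by (rule BL_deviation_lipschitz[OF Pd])
  moreover have "avg_norm n (\<lambda>i. e i - e i) = 0" by (simp add: avg_norm_def)
  ultimately show ?thesis using u(2) by linarith
qed


section \<open>From residual distributions to deviations\<close>

lemma integral_empirical_measure:
  fixes f :: "real \<Rightarrow> real"
  assumes "0 < n" "f \<in> borel_measurable borel"
  shows "(\<integral>y. f y \<partial>empirical_measure n w) = (\<Sum>i=1..n. f (w i)) / real n"
proof -
  have "w \<in> measurable (uniform_count_measure {1..n}) borel"
    by (auto simp: measurable_def sets_uniform_count_measure space_uniform_count_measure)
  then show ?thesis
    using assms by (simp add: empirical_measure_def integral_distr integral_uniform_count_measure)
qed

lemma integral_convolution_empirical_measure:
  assumes n: "0 < n" and P: "real_distribution P" and h: "h \<in> BL_functions"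
  shows "(\<integral>y. h y \<partial>convolution P (empirical_measure n w)) =
    (\<Sum>i=1..n. \<integral>y. h (y + w i) \<partial>P) / real n"
proof -
  let ?E = "empirical_measure n w"
  interpret P: real_distribution P by (rule P)
  interpret E: prob_space ?E by (rule prob_space_empirical_measure[OF n])
  interpret PE: pair_prob_space P ?E ..
  note [measurable] = BL_function_measurable[OF h]
  have int: "integrable (P \<Otimes>\<^sub>M ?E) (\<lambda>p. h (fst p + snd p))"
    using BL_functionsD(1)[OF h] by (intro PE.integrable_const_bound[where B=1]) auto
  have "(\<integral>y. h y \<partial>convolution P ?E) = (\<integral>p. h (fst p + snd p) \<partial>(P \<Otimes>\<^sub>M ?E))"
    unfolding convolution_def by (subst integral_distr) (auto simp: case_prod_beta)
  also have "\<dots> = (\<integral>y. \<integral>z. h (y + z) \<partial>?E \<partial>P)"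
    using PE.integral_fst'[OF int] by simp
  also have "\<dots> = (\<integral>y. (\<Sum>i=1..n. h (y + w i)) / real n \<partial>P)"
    by (intro Bochner_Integration.integral_cong refl integral_empirical_measure n) measurable
  also have "\<dots> = (\<Sum>i=1..n. \<integral>y. h (y + w i) \<partial>P) / real n"
  proof -
    have "integrable P (\<lambda>y. h (y + w i))" for i
      using BL_function_integrable[OF h P, of "- w i"] by simp
    then show ?thesis by simp
  qed
  finally show ?thesis .
qed

lemma BL_dist_eq_BL_deviation:
  assumes M: "prob_space M" and n: "0 < n" and P: "real_distribution P"
    and eps: "\<And>i. i \<in> {1..n} \<Longrightarrow> eps i \<in> borel_measurable M"
    and law: "\<And>i. i \<in> {1..n} \<Longrightarrow> distr M borel (eps i) = P"
    and Y: "\<And>i \<omega>. i \<in> {1..n} \<Longrightarrow> \<omega> \<in> space M \<Longrightarrow> Y i \<omega> = \<mu> (x i) + eps i \<omega>"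
    and \<omega>: "\<omega> \<in> space M"
  shows "BL_dist (residual_distribution n x Y m \<omega>) (expected_residual_distribution M n x Y m) =
    BL_deviation n P (\<lambda>i. m (x i) - \<mu> (x i)) (\<lambda>i. eps i \<omega>)"
  unfolding BL_dist_def BL_deviation_def
proof (rule SUP_cong[OF refl])
  fix h assume h: "h \<in> BL_functions"
  have "(\<integral>y. h y \<partial>residual_distribution n x Y m \<omega>) = (\<Sum>i=1..n. h (eps i \<omega> - (m (x i) - \<mu> (x i)))) / real n"
    unfolding residual_distribution_def integral_empirical_measure[OF n BL_function_measurable[OF h]]
    using Y[OF _ \<omega>] by (intro arg_cong2[where f="(/)"] sum.cong refl) (simp add: algebra_simps)
  moreover have "(\<integral>y. h y \<partial>expected_residual_distribution M n x Y m) =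
      (\<Sum>i=1..n. \<integral>y. h (y - (m (x i) - \<mu> (x i))) \<partial>P) / real n"
    using expected_residual_distribution_eq_convolution[where eps=eps and \<mu>=\<mu> and Q=P and Y=Y and x=x and m=m, OF M n eps law Y]
      integral_convolution_empirical_measure[OF n P h, of "\<lambda>i. \<mu> (x i) - m (x i)"]
    by (simp add: algebra_simps)
  ultimately show "\<bar>(\<integral>y. h y \<partial>residual_distribution n x Y m \<omega>) -
      (\<integral>y. h y \<partial>expected_residual_distribution M n x Y m)\<bar> =
      \<bar>deviation n P h (\<lambda>i. m (x i) - \<mu> (x i)) (\<lambda>i. eps i \<omega>)\<bar>"
    by (simp add: deviation_def sum_subtractf diff_divide_distrib)
qed

lemma BL_deviation_le_2:
  assumes "real_distribution P"
  shows "BL_deviation n P v e \<le> 2"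
  by (intro BL_deviation_least abs_deviation_le_2 assms)

text \<open>A supremum over uncountably many \<open>v\<close> and \<open>h\<close> is measurable because it is a Lipschitz, hence
  continuous, function of the errors.\<close>

lemma SUP_BL_deviation_measurable:
  assumes P: "real_distribution P" and W: "W \<noteq> {}"
    and eps: "\<And>i. i \<in> {1..n} \<Longrightarrow> eps i \<in> borel_measurable M"
  shows "(\<lambda>\<omega>. SUP v\<in>W. BL_deviation n P v (\<lambda>i. eps i \<omega>)) \<in> borel_measurable M"
proof -
  define F where "F e = (SUP v\<in>W. BL_deviation n P v e)" for e
  have bdd: "bdd_above ((\<lambda>v. BL_deviation n P v e) ` W)" for e
    using BL_deviation_le_2[OF P] by (intro bdd_aboveI2[where M=2])
  have le: "F e \<le> F e' + avg_norm n (\<lambda>i. e i - e' i)" for e e'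
    unfolding F_def
  proof (rule cSUP_least[OF W])
    fix v assume v: "v \<in> W"
    have "BL_deviation n P v e \<le> BL_deviation n P v e' +
        (avg_norm n (\<lambda>i. e i - e' i) + 2 * avg_norm n (\<lambda>i. v i - v i))"
      by (rule BL_deviation_lipschitz[OF P])
    also have "BL_deviation n P v e' \<le> (SUP v\<in>W. BL_deviation n P v e')"
      by (rule cSUP_upper[OF v bdd])
    finally show "BL_deviation n P v e \<le> (SUP v\<in>W. BL_deviation n P v e') + avg_norm n (\<lambda>i. e i - e' i)"
      by (simp add: avg_norm_def)
  qed
  have lip: "\<bar>F e' - F e\<bar> \<le> avg_norm n (\<lambda>i. e' i - e i)" for e e'
  proof -
    have "avg_norm n (\<lambda>i. e i - e' i) = avg_norm n (\<lambda>i. e' i - e i)"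
      by (rule avg_norm_cong) (simp add: abs_minus_commute)
    with le[of e e'] le[of e' e] show ?thesis by linarith
  qed
  have "continuous_on UNIV F"
  proof (rule continuous_at_imp_continuous_on, rule ballI)
    fix e :: "nat \<Rightarrow> real"
    have "continuous_on UNIV (\<lambda>e'. avg_norm n (\<lambda>i. e' i - e i))"
      unfolding avg_norm_def divide_inverse by (intro continuous_intros) auto
    then have "(\<lambda>e'. avg_norm n (\<lambda>i. e' i - e i)) \<midarrow>e\<rightarrow> avg_norm n (\<lambda>i. e i - e i)"
      unfolding continuous_on_def by (rule bspec) simp
    then have "(\<lambda>e'. avg_norm n (\<lambda>i. e' i - e i)) \<midarrow>e\<rightarrow> 0"
      by (simp add: avg_norm_def)
    then have "(\<lambda>e'. F e' - F e) \<midarrow>e\<rightarrow> 0"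
      by (rule Lim_null_comparison[rotated]) (simp add: lip)
    then show "isCont F e" unfolding isCont_def by (rule LIM_zero_cancel)
  qed
  then have F: "F \<in> borel_measurable borel" by (rule borel_measurable_continuous_onI)
  have "(\<lambda>\<omega> i. if i \<in> {1..n} then eps i \<omega> else 0) \<in> borel_measurable M"
  proof (rule measurable_coordinatewise_then_product)
    fix i show "(\<lambda>\<omega>. if i \<in> {1..n} then eps i \<omega> else 0) \<in> borel_measurable M"
      using eps by (cases "i \<in> {1..n}") (simp_all del: atLeastAtMost_iff)
  qed
  from measurable_compose[OF this F]
  have "(\<lambda>\<omega>. F (\<lambda>i. if i \<in> {1..n} then eps i \<omega> else 0)) \<in> borel_measurable M" .
  moreover have "F (\<lambda>i. if i \<in> {1..n} then e i else 0) = F e" for e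
  proof -
    have "avg_norm n (\<lambda>i. (if i \<in> {1..n} then e i else 0) - e i) = 0"
      by (simp add: avg_norm_def)
    with lip[of "\<lambda>i. if i \<in> {1..n} then e i else 0" e] show ?thesis by simp
  qed
  ultimately show ?thesis by (simp add: F_def)
qed


section \<open>Tail bounds for a fixed sample size\<close>

context prob_space
begin

lemma deviation_Hoeffding:
  assumes n: "0 < n" and h: "h \<in> BL_functions" and t: "0 \<le> t"
    and indep: "indep_vars (\<lambda>_. borel) eps {1..n}"
    and law: "\<And>i. i \<in> {1..n} \<Longrightarrow> distr M borel (eps i) = P"
  shows "prob {\<omega> \<in> space M. t \<le> \<bar>deviation n P h v (\<lambda>i. eps i \<omega>)\<bar>} \<le> 2 * exp (- (real n * (t\<^sup>2 / 2)))"
proof -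
  note h_meas [measurable] = BL_function_measurable[OF h]
  have eps [measurable]: "eps i \<in> borel_measurable M" if "i \<in> {1..n}" for i
    using indep that by (simp add: indep_vars_def)
  have "indep_vars (\<lambda>_. borel) (\<lambda>i \<omega>. h (eps i \<omega> - v i)) {1..n}"
    by (rule indep_vars_compose2[OF indep]) measurable
  moreover have "h (eps i \<omega> - v i) \<in> {-1..1}" for i \<omega>
    using h by (auto simp: BL_functions_def)
  ultimately interpret Hoeffding_ineq M "{1..n}" "\<lambda>i \<omega>. h (eps i \<omega> - v i)" "\<lambda>_. -1" "\<lambda>_. 1"
      "\<Sum>i=1..n. expectation (\<lambda>\<omega>. h (eps i \<omega> - v i))"
    by unfold_locales auto
  have E: "expectation (\<lambda>\<omega>. h (eps i \<omega> - v i)) = (\<integral>y. h (y - v i) \<partial>P)" if "i \<in> {1..n}" for i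
    using eps[OF that] unfolding law[OF that, symmetric] by (subst integral_distr) auto
  have "{\<omega> \<in> space M. t \<le> \<bar>deviation n P h v (\<lambda>i. eps i \<omega>)\<bar>} =
      {\<omega> \<in> space M. real n * t \<le> \<bar>(\<Sum>i=1..n. h (eps i \<omega> - v i)) -
        (\<Sum>i=1..n. expectation (\<lambda>\<omega>. h (eps i \<omega> - v i)))\<bar>}"
    using n by (simp add: deviation_def sum_subtractf E abs_divide field_simps)
  also have "prob \<dots> \<le> 2 * exp (- 2 * (real n * t)\<^sup>2 / (\<Sum>i=1..n. (1 - - 1)\<^sup>2))"
    using t n by (intro Hoeffding_ineq_abs_ge) auto
  also have "- 2 * (real n * t)\<^sup>2 / (\<Sum>i=1..n. (1 - - 1)\<^sup>2) = - (real n * (t\<^sup>2 / 2))"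
    using n by (simp add: power2_eq_square field_simps)
  finally show ?thesis .
qed

lemma avg_norm_Markov:
  assumes n: "0 < n" and B: "0 < B" and P: "P \<in> integrable_distributions"
    and eps: "\<And>i. i \<in> {1..n} \<Longrightarrow> eps i \<in> borel_measurable M"
    and law: "\<And>i. i \<in> {1..n} \<Longrightarrow> distr M borel (eps i) = P"
  shows "prob {\<omega> \<in> space M. B \<le> avg_norm n (\<lambda>i. eps i \<omega>)} \<le> (\<integral>y. \<bar>y\<bar> \<partial>P) / B"
proof -
  have Pi: "integrable P (\<lambda>y. \<bar>y\<bar>)" using P by (auto simp: integrable_distributions_def)
  have int: "integrable M (\<lambda>\<omega>. \<bar>eps i \<omega>\<bar>)" if "i \<in> {1..n}" for i
    using Pi eps[OF that] unfolding law[OF that, symmetric] by (subst (asm) integrable_distr_eq) auto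
  have E: "(\<integral>\<omega>. \<bar>eps i \<omega>\<bar> \<partial>M) = (\<integral>y. \<bar>y\<bar> \<partial>P)" if "i \<in> {1..n}" for i
    using eps[OF that] unfolding law[OF that, symmetric] by (subst integral_distr) auto
  have "prob {\<omega> \<in> space M. B \<le> avg_norm n (\<lambda>i. eps i \<omega>)} \<le> (\<integral>\<omega>. avg_norm n (\<lambda>i. eps i \<omega>) \<partial>M) / B"
  proof (intro integral_Markov_inequality_measure[where A="{}"] B AE_I2 avg_norm_nonneg)
    show "integrable M (\<lambda>\<omega>. avg_norm n (\<lambda>i. eps i \<omega>))"
      unfolding avg_norm_def by (intro integrable_divide Bochner_Integration.integrable_sum int)
  qed simp
  also have "(\<integral>\<omega>. avg_norm n (\<lambda>i. eps i \<omega>) \<partial>M) = (\<integral>y. \<bar>y\<bar> \<partial>P)"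
    using n int by (simp add: avg_norm_def E)
  finally show ?thesis .
qed

text \<open>Union bound over the pairs of a net point \<open>u\<close> and a test function \<open>g\<close> (events \<open>D\<close>, each by
  Hoeffding's inequality) and the event \<open>A\<close> that the errors are large on average.\<close>

lemma SUP_BL_deviation_tail:
  assumes n: "0 < n" and P: "P \<in> integrable_distributions"
    and indep: "indep_vars (\<lambda>_. borel) eps {1..n}"
    and law: "\<And>i. i \<in> {1..n} \<Longrightarrow> distr M borel (eps i) = P"
    and W: "W \<noteq> {}" "W \<subseteq> combinations_ball n d b c"
    and c: "0 < c" and \<delta>: "0 < \<delta>" "\<delta> \<le> c" "\<delta> \<le> 1" and k: "8 * c / \<delta> \<le> real k"
    and K: "0 < K" and B: "0 < B"
    and H: "H \<subseteq> BL_functions" "finite H"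
      "\<And>h. h \<in> BL_functions \<Longrightarrow> \<exists>g\<in>H. \<forall>r. \<bar>h r - g r\<bar> \<le> \<delta> + 2 / K * \<bar>r\<bar>"
    and \<kappa>: "5 * \<delta> + 2 / K * (B + (\<integral>y. \<bar>y\<bar> \<partial>P) + 2 * c) \<le> \<kappa>"
  shows "prob {\<omega> \<in> space M. \<kappa> < (SUP v\<in>W. BL_deviation n P v (\<lambda>i. eps i \<omega>))} \<le>
    2 * real (card H) * (real k ^ d * exp (- (real n * (\<delta>\<^sup>2 / 2)))) + (\<integral>y. \<bar>y\<bar> \<partial>P) / B"
proof -
  have Pd: "real_distribution P" using P by (simp add: integrable_distributions_def)
  have eps: "eps i \<in> borel_measurable M" if "i \<in> {1..n}" for i
    using indep that by (simp add: indep_vars_def)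
  obtain S where S: "S \<subseteq> combinations_ball n d b c" "finite S" "card S \<le> k ^ d"
    "\<And>v. v \<in> combinations_ball n d b c \<Longrightarrow> \<exists>u\<in>S. avg_norm n (\<lambda>i. v i - u i) \<le> \<delta>"
    using ball_covering[OF c \<delta> k, of n d b] by blast
  define D where "D p = {\<omega> \<in> space M. \<delta> \<le> \<bar>deviation n P (snd p) (fst p) (\<lambda>i. eps i \<omega>)\<bar>}"
    for p :: "(nat \<Rightarrow> real) \<times> (real \<Rightarrow> real)"
  define A where "A = {\<omega> \<in> space M. B \<le> avg_norm n (\<lambda>i. eps i \<omega>)}"
  have D_sets: "D p \<in> events" if "p \<in> S \<times> H" for p
  proof -
    have [measurable]: "snd p \<in> borel_measurable borel"
      using that H(1) by (intro BL_function_measurable) auto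
    have "(\<lambda>\<omega>. deviation n P (snd p) (fst p) (\<lambda>i. eps i \<omega>)) \<in> borel_measurable M"
      unfolding deviation_def
      by (intro borel_measurable_divide borel_measurable_sum borel_measurable_diff borel_measurable_const
          measurable_compose[OF eps]) measurable
    then show ?thesis unfolding D_def by measurable
  qed
  have A_sets: "A \<in> events"
  proof -
    have "(\<lambda>\<omega>. avg_norm n (\<lambda>i. eps i \<omega>)) \<in> borel_measurable M"
      unfolding avg_norm_def using eps by (intro borel_measurable_divide borel_measurable_sum) auto
    then show ?thesis unfolding A_def by measurable
  qed
  have "{\<omega> \<in> space M. \<kappa> < (SUP v\<in>W. BL_deviation n P v (\<lambda>i. eps i \<omega>))} \<subseteq> (\<Union>p\<in>S \<times> H. D p) \<union> A"
  proof (rule subsetI, rule ccontr)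
    fix \<omega> assume \<omega>: "\<omega> \<in> {\<omega> \<in> space M. \<kappa> < (SUP v\<in>W. BL_deviation n P v (\<lambda>i. eps i \<omega>))}"
      and no: "\<omega> \<notin> (\<Union>p\<in>S \<times> H. D p) \<union> A"
    have small: "\<bar>deviation n P g u (\<lambda>i. eps i \<omega>)\<bar> \<le> \<delta>" if "u \<in> S" "g \<in> H" for u g
    proof -
      have "\<omega> \<notin> D (u, g)" using no that by blast
      then show ?thesis using \<omega> by (simp add: D_def)
    qed
    have avg: "avg_norm n (\<lambda>i. eps i \<omega>) \<le> B" using no \<omega> by (auto simp: A_def)
    have "(SUP v\<in>W. BL_deviation n P v (\<lambda>i. eps i \<omega>)) \<le> \<kappa>"
    proof (rule cSUP_least[OF W(1)])
      fix v assume "v \<in> W"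
      then have "BL_deviation n P v (\<lambda>i. eps i \<omega>) \<le>
          5 * \<delta> + 2 / K * (avg_norm n (\<lambda>i. eps i \<omega>) + (\<integral>y. \<bar>y\<bar> \<partial>P) + 2 * c)"
        using W(2) by (intro BL_deviation_le_nets[OF P n K S(1,4) H(1,3) small]) auto
      also have "\<dots> \<le> 5 * \<delta> + 2 / K * (B + (\<integral>y. \<bar>y\<bar> \<partial>P) + 2 * c)"
        using K avg by (intro add_left_mono mult_left_mono) auto
      finally show "BL_deviation n P v (\<lambda>i. eps i \<omega>) \<le> \<kappa>" using \<kappa> by linarith
    qed
    then show False using \<omega> by simp
  qed
  then have "prob {\<omega> \<in> space M. \<kappa> < (SUP v\<in>W. BL_deviation n P v (\<lambda>i. eps i \<omega>))} \<le>
      prob ((\<Union>p\<in>S \<times> H. D p) \<union> A)"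
    using D_sets A_sets S(2) H(2) by (intro finite_measure_mono sets.Un sets.finite_UN) auto
  also have "\<dots> \<le> prob (\<Union>p\<in>S \<times> H. D p) + prob A"
    using D_sets A_sets S(2) H(2) by (intro measure_Un_le sets.finite_UN) auto
  also have "prob A \<le> (\<integral>y. \<bar>y\<bar> \<partial>P) / B"
    unfolding A_def by (rule avg_norm_Markov[OF n B P eps law])
  also have "prob (\<Union>p\<in>S \<times> H. D p) \<le> (\<Sum>p\<in>S \<times> H. prob (D p))"
    using D_sets S(2) H(2) by (intro measure_UNION_le) auto
  also have "\<dots> \<le> (\<Sum>p\<in>S \<times> H. 2 * exp (- (real n * (\<delta>\<^sup>2 / 2))))"
    unfolding D_def using H(1) \<delta>(1) by (intro sum_mono deviation_Hoeffding n indep law) auto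
  also have "\<dots> = real (card S) * real (card H) * (2 * exp (- (real n * (\<delta>\<^sup>2 / 2))))"
    by (simp add: card_cartesian_product)
  also have "\<dots> \<le> real k ^ d * real (card H) * (2 * exp (- (real n * (\<delta>\<^sup>2 / 2))))"
    using S(3) by (intro mult_right_mono) (auto simp flip: of_nat_power)
  finally show ?thesis by (simp add: mult_ac)
qed

end

section \<open>The limit\<close>

text \<open>Convergence in the Mallows distance enters the theorem through this bound, which makes the first
  moments of the error distributions eventually bounded.\<close>

lemma first_moment_le_mallows:
  assumes Q': "Q' \<in> integrable_distributions" and Q: "Q \<in> integrable_distributions"
    and D: "mallows_dist Q' Q < 1"
  shows "(\<integral>y. \<bar>y\<bar> \<partial>Q') \<le> (\<integral>y. \<bar>y\<bar> \<partial>Q) + 1"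
proof -
  obtain R where R: "R \<in> couplings Q' Q" and R1: "(\<integral>\<^sup>+ (x, x'). ennreal \<bar>x - x'\<bar> \<partial>R) < 1"
    using D unfolding mallows_dist_def by (auto simp: INF_less_iff)
  have sR: "sets R = sets borel" and d1: "Q' = distr R borel fst" and d2: "Q = distr R borel snd"
    using R by (auto simp: couplings_def)
  have [measurable]: "fst \<in> borel_measurable R" "snd \<in> borel_measurable R"
    unfolding measurable_cong_sets[OF sR refl]
    by (auto intro!: borel_measurable_continuous_onI continuous_intros)
  have Q'i: "integrable Q' (\<lambda>y. \<bar>y\<bar>)" and Qi: "integrable Q (\<lambda>y. \<bar>y\<bar>)"
    using Q Q' by (auto simp: integrable_distributions_def)
  have "ennreal (\<integral>y. \<bar>y\<bar> \<partial>Q') = (\<integral>\<^sup>+y. ennreal \<bar>y\<bar> \<partial>Q')"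
    using Q'i by (simp add: nn_integral_eq_integral)
  also have "\<dots> = (\<integral>\<^sup>+p. ennreal \<bar>fst p\<bar> \<partial>R)"
    unfolding d1 by (subst nn_integral_distr) auto
  also have "\<dots> \<le> (\<integral>\<^sup>+p. ennreal \<bar>fst p - snd p\<bar> + ennreal \<bar>snd p\<bar> \<partial>R)"
    by (intro nn_integral_mono) (simp flip: ennreal_plus)
  also have "\<dots> = (\<integral>\<^sup>+p. ennreal \<bar>fst p - snd p\<bar> \<partial>R) + (\<integral>\<^sup>+p. ennreal \<bar>snd p\<bar> \<partial>R)"
    by (rule nn_integral_add) measurable
  also have "\<dots> \<le> 1 + (\<integral>\<^sup>+p. ennreal \<bar>snd p\<bar> \<partial>R)"
    using R1 by (intro add_right_mono) (simp add: case_prod_unfold less_imp_le)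
  also have "(\<integral>\<^sup>+p. ennreal \<bar>snd p\<bar> \<partial>R) = (\<integral>\<^sup>+y. ennreal \<bar>y\<bar> \<partial>Q)"
    unfolding d2 by (subst nn_integral_distr) auto
  also have "\<dots> = ennreal (\<integral>y. \<bar>y\<bar> \<partial>Q)"
    using Qi by (simp add: nn_integral_eq_integral)
  also have "1 + ennreal (\<integral>y. \<bar>y\<bar> \<partial>Q) = ennreal ((\<integral>y. \<bar>y\<bar> \<partial>Q) + 1)"
    by (simp add: ennreal_plus add.commute)
  finally show ?thesis
    by (subst (asm) ennreal_le_iff) (auto intro!: add_nonneg_nonneg)
qed

text \<open>The cardinality of the nets is \<open>exp (o(n))\<close> and loses against the exponential tail.\<close>

lemma power_times_exp_tendsto_0:
  fixes q :: "nat \<Rightarrow> nat" and k a :: real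
  assumes q: "(\<lambda>n. real (q n) / real n) \<longlonglongrightarrow> 0" and k: "1 \<le> k" and a: "0 < a"
  shows "(\<lambda>n. k ^ Suc (q n) * exp (- (real n * a))) \<longlonglongrightarrow> 0"
proof (rule tendsto_sandwich[where f="\<lambda>_. 0"])
  have "0 < a / 2 / (ln k + 1)" using a k by (intro divide_pos_pos) (auto intro: add_nonneg_pos)
  then have "eventually (\<lambda>n. real (q n) / real n < a / 2 / (ln k + 1)) sequentially"
    using q by (rule order_tendstoD(2)[rotated])
  then show "eventually (\<lambda>n. k ^ Suc (q n) * exp (- (real n * a)) \<le> k * exp (- (a / 2) * real n)) sequentially"
    using eventually_gt_at_top[of 0]
  proof eventually_elim
    case (elim n)
    have l: "0 \<le> ln k" using k by simp
    then have "real (q n) * (ln k + 1) \<le> a / 2 * real n" using elim by (simp add: field_simps)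
    then have "real (q n) * ln k \<le> a / 2 * real n" by (simp add: distrib_left)
    then have "exp (real (q n) * ln k) \<le> exp (a / 2 * real n)" by simp
    also have "exp (real (q n) * ln k) = k ^ q n" using k by (simp add: exp_of_nat_mult)
    finally have "k * (k ^ q n * exp (- (real n * a))) \<le> k * (exp (a / 2 * real n) * exp (- (real n * a)))"
      using k by (intro mult_left_mono mult_right_mono) auto
    also have "exp (a / 2 * real n) * exp (- (real n * a)) = exp (- (a / 2) * real n)"
      by (simp add: algebra_simps flip: exp_add)
    finally show ?case by (simp add: mult.assoc)
  qed
  have "(\<lambda>n. exp (- (a / 2) * real n)) \<longlonglongrightarrow> 0"
    using a by real_asymp
  then show "(\<lambda>n. k * exp (- (a / 2) * real n)) \<longlonglongrightarrow> 0"
    using tendsto_mult_right_zero by blast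
qed (use k in auto)

text \<open>The generator with index 0 is the constant, and those after it are the coordinates.\<close>

lemma affine_difference_combination:
  assumes m: "m \<in> affine_functions q" "m' \<in> affine_functions q"
    and x: "\<And>i. i \<in> {1..n} \<Longrightarrow> x i \<in> topspace (Euclidean_space q)"
  shows "(\<lambda>i. m (x i) - m' (x i)) \<in> combinations n (Suc q) (\<lambda>j i. case j of 0 \<Rightarrow> 1 | Suc j \<Rightarrow> x i j)"
proof -
  obtain a s where 1: "\<And>y. y \<in> topspace (Euclidean_space q) \<Longrightarrow> m y = a + (\<Sum>j<q. s j * y j)"
    using m(1) by (auto simp: affine_functions_def)
  obtain a' s' where 2: "\<And>y. y \<in> topspace (Euclidean_space q) \<Longrightarrow> m' y = a' + (\<Sum>j<q. s' j * y j)"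
    using m(2) by (auto simp: affine_functions_def)
  show ?thesis
    unfolding combinations_def
    by (intro CollectI exI[of _ "\<lambda>j. case j of 0 \<Rightarrow> a - a' | Suc j \<Rightarrow> s j - s' j"] ballI)
      (simp add: 1[OF x] 2[OF x] sum.lessThan_Suc_shift left_diff_distrib sum_subtractf del: sum.lessThan_Suc)
qed

theorem theorem3p7:
  fixes M :: "nat \<Rightarrow> 'a measure"
    and q :: "nat \<Rightarrow> nat"
    and x :: "nat \<Rightarrow> nat \<Rightarrow> (nat \<Rightarrow> real)"
    and \<mu> :: "nat \<Rightarrow> (nat \<Rightarrow> real) \<Rightarrow> real"
    and \<epsilon> Y :: "nat \<Rightarrow> nat \<Rightarrow> 'a \<Rightarrow> real"
    and Qn :: "nat \<Rightarrow> real measure"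
    and Q :: "real measure"
    and c :: real
  assumes prob: "\<And>n. n \<ge> 1 \<Longrightarrow> prob_space (M n)"
    and design: "\<And>n i. n \<ge> 1 \<Longrightarrow> i \<in> {1..n} \<Longrightarrow> x n i \<in> topspace (Euclidean_space (q n))"
    and regression: "\<And>n. n \<ge> 1 \<Longrightarrow> \<mu> n \<in> affine_functions (q n)"
    and indep: "\<And>n. n \<ge> 1 \<Longrightarrow> prob_space.indep_vars (M n) (\<lambda>_. borel) (\<epsilon> n) {1..n}"
    and law: "\<And>n i. n \<ge> 1 \<Longrightarrow> i \<in> {1..n} \<Longrightarrow> distr (M n) borel (\<epsilon> n i) = Qn n"
    and mean_zero: "\<And>n i. n \<ge> 1 \<Longrightarrow> i \<in> {1..n} \<Longrightarrow> prob_space.expectation (M n) (\<epsilon> n i) = 0"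
    and Qn: "\<And>n. n \<ge> 1 \<Longrightarrow> Qn n \<in> nondegenerate_distributions \<inter> integrable_distributions"
    and observations: "\<And>n i \<omega>. n \<ge> 1 \<Longrightarrow> i \<in> {1..n} \<Longrightarrow> \<omega> \<in> space (M n) \<Longrightarrow>
           Y n i \<omega> = \<mu> n (x n i) + \<epsilon> n i \<omega>"
    and Q: "Q \<in> nondegenerate_distributions \<inter> integrable_distributions"
    and Qn_tendsto: "(\<lambda>n. mallows_dist (Qn n) Q) \<longlonglongrightarrow> 0"
    and dimension: "(\<lambda>n. real (q n) / real n) \<longlonglongrightarrow> 0"
    and c: "c > 0"
  shows "tendsto_in_probability M
           (\<lambda>n \<omega>. SUP m \<in> {m \<in> affine_functions (q n). avg_norm n (\<lambda>i. m (x n i) - \<mu> n (x n i)) \<le> c}.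
              BL_dist (residual_distribution n (x n) (Y n) m \<omega>)
                      (expected_residual_distribution (M n) n (x n) (Y n) m))
           0"

proof -
  define A where "A n = {m \<in> affine_functions (q n). avg_norm n (\<lambda>i. m (x n i) - \<mu> n (x n i)) \<le> c}" for n
  define W where "W n = (\<lambda>m i. m (x n i) - \<mu> n (x n i)) ` A n" for n
  define X where "X = (\<lambda>n \<omega>. SUP m \<in> A n. BL_dist (residual_distribution n (x n) (Y n) m \<omega>)
      (expected_residual_distribution (M n) n (x n) (Y n) m))"
  have Pi: "Qn n \<in> integrable_distributions" and Pd: "real_distribution (Qn n)" if "n \<ge> 1" for n
    using Qn[OF that] by (auto simp: integrable_distributions_def)
  have eps: "\<epsilon> n i \<in> borel_measurable (M n)" if "n \<ge> 1" "i \<in> {1..n}" for n i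
    using indep[OF that(1)] that(2) by (simp add: prob_space.indep_vars_def2[OF prob[OF that(1)]])
  have X_eq: "X n \<omega> = (SUP v\<in>W n. BL_deviation n (Qn n) v (\<lambda>i. \<epsilon> n i \<omega>))"
    if n: "n \<ge> 1" and \<omega>: "\<omega> \<in> space (M n)" for n \<omega>
  proof -
    have "BL_dist (residual_distribution n (x n) (Y n) m \<omega>) (expected_residual_distribution (M n) n (x n) (Y n) m) =
        BL_deviation n (Qn n) (\<lambda>i. m (x n i) - \<mu> n (x n i)) (\<lambda>i. \<epsilon> n i \<omega>)" for m
      using n by (intro BL_dist_eq_BL_deviation[where eps="\<epsilon> n" and x="x n" and \<mu>="\<mu> n"]
          prob[OF n] Pd[OF n] eps[OF n] law[OF n] observations[OF n] \<omega>) simp_all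
    then show ?thesis by (simp add: X_def W_def image_image)
  qed
  have "\<mu> n \<in> A n" if "n \<ge> 1" for n
    using regression[OF that] c by (simp add: A_def avg_norm_def)
  then have W_ne: "W n \<noteq> {}" if "n \<ge> 1" for n
    using that unfolding W_def by blast
  have W_ball: "W n \<subseteq> combinations_ball n (Suc (q n)) (\<lambda>j i. case j of 0 \<Rightarrow> 1 | Suc j \<Rightarrow> x n i j) c"
    if n: "n \<ge> 1" for n
    using affine_difference_combination[OF _ regression[OF n] design[OF n]]
    by (auto simp: W_def A_def combinations_ball_def)
  have X_meas: "X n \<in> borel_measurable (M n)" if n: "n \<ge> 1" for n
    using SUP_BL_deviation_measurable[OF Pd[OF n] W_ne[OF n] eps[OF n]]
    by (subst measurable_cong[OF X_eq[OF n]])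
  define L where "L = (\<integral>y. \<bar>y\<bar> \<partial>Q) + 1"
  have L: "0 < L" unfolding L_def by (intro add_nonneg_pos) auto
  have "eventually (\<lambda>n. mallows_dist (Qn n) Q < 1) sequentially"
    using Qn_tendsto by (rule order_tendstoD) simp
  then have moment: "eventually (\<lambda>n. (\<integral>y. \<bar>y\<bar> \<partial>Qn n) \<le> L) sequentially"
    using eventually_ge_at_top[of 1]
  proof eventually_elim
    case (elim n)
    show ?case
      unfolding L_def using elim Q Pi by (intro first_moment_le_mallows) auto
  qed
  have "(\<lambda>n. measure (M n) {\<omega> \<in> space (M n). \<bar>X n \<omega> - 0\<bar> > \<kappa>}) \<longlonglongrightarrow> 0" if \<kappa>: "\<kappa> > 0" for \<kappa>
  proof (rule tendstoI)
    fix \<eta> :: real assume \<eta>: "\<eta> > 0"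
    \<comment> \<open>The bound \<open>B\<close> on the average absolute error fails with probability at most \<open>\<eta> / 2\<close>. The
      constants \<open>\<delta>\<close> and \<open>K\<close> are such that the fineness of the nets and the tails outside of
      \<open>[-K, K]\<close> contribute at most \<open>\<kappa> / 2\<close> each.\<close>
    define B where "B = 2 * L / \<eta>"
    have B: "0 < B" using L \<eta> by (simp add: B_def)
    define \<delta> where "\<delta> = min (\<kappa> / 10) (min c 1)"
    have \<delta>: "0 < \<delta>" "\<delta> \<le> c" "\<delta> \<le> 1" "5 * \<delta> \<le> \<kappa> / 2" using \<kappa> c by (auto simp: \<delta>_def)
    define K where "K = 4 * (B + L + 2 * c) / \<kappa>"
    have "0 < B + L + 2 * c" using B L c by simp
    moreover have "2 / (4 * s / \<kappa>) * s = \<kappa> / 2" if "0 < s" for s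
      using \<kappa> that by (simp add: field_simps)
    ultimately have K: "0 < K" "2 / K * (B + L + 2 * c) = \<kappa> / 2"
      using \<kappa> unfolding K_def by (simp_all only: divide_pos_pos mult_pos_pos zero_less_numeral)
    define k where "k = nat \<lceil>8 * c / \<delta>\<rceil>"
    have k: "8 * c / \<delta> \<le> real k" unfolding k_def by linarith
    have "1 \<le> 8 * c / \<delta>" using \<delta> c by (simp add: field_simps)
    with k have k1: "1 \<le> real k" by linarith
    obtain H where H: "H \<subseteq> BL_functions" "finite H"
        "\<And>h. h \<in> BL_functions \<Longrightarrow> \<exists>g\<in>H. \<forall>r. \<bar>h r - g r\<bar> \<le> \<delta> + 2 / K * \<bar>r\<bar>"
      using BL_functions_finite_net[OF K(1) \<delta>(1)] by blast
    have "(\<lambda>n. real k ^ Suc (q n) * exp (- (real n * (\<delta>\<^sup>2 / 2)))) \<longlonglongrightarrow> 0"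
      using \<delta>(1) by (intro power_times_exp_tendsto_0 dimension k1) simp
    then have "(\<lambda>n. 2 * real (card H) * (real k ^ Suc (q n) * exp (- (real n * (\<delta>\<^sup>2 / 2))))) \<longlonglongrightarrow> 0"
      by (rule tendsto_mult_right_zero)
    then have "eventually (\<lambda>n. 2 * real (card H) * (real k ^ Suc (q n) * exp (- (real n * (\<delta>\<^sup>2 / 2)))) < \<eta> / 2) sequentially"
      using \<eta> by (intro order_tendstoD(2)[where a="\<eta> / 2"]) auto
    then show "eventually (\<lambda>n. dist (measure (M n) {\<omega> \<in> space (M n). \<bar>X n \<omega> - 0\<bar> > \<kappa>}) 0 < \<eta>) sequentially"
      using moment eventually_ge_at_top[of 1]
    proof eventually_elim
      case (elim n)
      then have n: "n \<ge> 1" "0 < n" by auto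
      interpret prob_space "M n" by (rule prob[OF n(1)])
      have pos: "0 \<le> X n \<omega>" if "\<omega> \<in> space (M n)" for \<omega>
      proof -
        obtain v where v: "v \<in> W n" using W_ne[OF n(1)] by blast
        have "0 \<le> BL_deviation n (Qn n) v (\<lambda>i. \<epsilon> n i \<omega>)" by (rule BL_deviation_nonneg[OF Pd[OF n(1)]])
        also have "\<dots> \<le> X n \<omega>"
          unfolding X_eq[OF n(1) that] using BL_deviation_le_2[OF Pd[OF n(1)]]
          by (intro cSUP_upper v bdd_aboveI2[where M=2])
        finally show ?thesis .
      qed
      have "{\<omega> \<in> space (M n). \<bar>X n \<omega> - 0\<bar> > \<kappa>} =
          {\<omega> \<in> space (M n). \<kappa> < (SUP v\<in>W n. BL_deviation n (Qn n) v (\<lambda>i. \<epsilon> n i \<omega>))}"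
        using pos X_eq[OF n(1)] by auto
      also have "prob \<dots> \<le> 2 * real (card H) * (real k ^ Suc (q n) * exp (- (real n * (\<delta>\<^sup>2 / 2)))) +
          (\<integral>y. \<bar>y\<bar> \<partial>Qn n) / B"
      proof (rule SUP_BL_deviation_tail[OF n(2) Pi[OF n(1)] indep[OF n(1)] law[OF n(1)] W_ne[OF n(1)]
            W_ball[OF n(1)] c \<delta>(1-3) k K(1) B H])
        have "2 / K * (B + (\<integral>y. \<bar>y\<bar> \<partial>Qn n) + 2 * c) \<le> 2 / K * (B + L + 2 * c)"
          using K(1) elim(2) by (intro mult_left_mono) auto
        then show "5 * \<delta> + 2 / K * (B + (\<integral>y. \<bar>y\<bar> \<partial>Qn n) + 2 * c) \<le> \<kappa>"
          using K(2) \<delta>(4) by linarith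
      qed
      also have "(\<integral>y. \<bar>y\<bar> \<partial>Qn n) / B \<le> L / B"
        using B elim(2) by (intro divide_right_mono) auto
      also have "L / B = \<eta> / 2" using L \<eta> by (simp add: B_def)
      finally show ?case using elim(1) by (simp add: dist_real_def)
    qed
  qed
  moreover have "eventually (\<lambda>n. X n \<in> borel_measurable (M n)) sequentially"
    using eventually_ge_at_top[of 1] by eventually_elim (rule X_meas)
  ultimately have "tendsto_in_probability M X 0"
    unfolding tendsto_in_probability_def by blast
  then show ?thesis unfolding X_def A_def .
qed

end
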